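(* Let $p$ be a prime, $J\subset\mathbf{N}$ a subset, $\omega$ a nonprincipal ultrafilter on $\mathbf{N}$, and $G=\mathrm{Cone}_\omega\big(\mathbf{F}_p^{(J)}\big)$. Let $\epsilon_0$ be the infinite countable cardinal and $\epsilon_1=2^{\epsilon_0}$ the continuum cardinal, and let $\simeq$ denote isomorphism of topological groups. Then: (A) If $G$ is discrete, then - if $G$ is bounded and proper, $G\simeq\mathbf{F}_p^n$ for some finite $n$; - if $G$ is unbounded and proper, $G\simeq\mathbf{F}_p^{(\epsilon_0)}$; - if $G$ is not proper, $G\simeq\mathbf{F}_p^{(\epsilon_1)}$. (B) If $G$ is locally compact and not discrete, then - if $G$ is compact (i.e. bounded and proper), $G\simeq\mathbf{F}_p^{\epsilon_0}$; - if $G$ is unbounded and proper, $G\simeq\mathbf{F}_p^{\epsilon_0}\times\mathbf{F}_p^{(\epsilon_0)}$; - if $G$ is not proper, $G\simeq\mathbf{F}_p^{\epsilon_0}\times\mathbf{F}_p^{(\epsilon_1)}$. (C) If $G$ is not locally compact, then $G\simeq\big(\mathbf{F}_p^{(\epsilon_1)}\big)^{\epsilon_0}$.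
   Context: $\mathbf{N}$ is the set of positive integers. $\mathbf{F}_p^{(\mathbf{N})}$ is the $\mathbf{F}_p$-vector space with basis $(\delta_n)_{n\in\mathbf{N}}$, with the invariant ultrametric distance defined by the length $|u|=\sup\{n:u_n\ne0\}$ (and $|0|=0$). For $J\subset\mathbf{N}$, $\mathbf{F}_p^{(J)}$ is the subgroup of elements supported in $J$, with the induced metric. For a metric abelian group $(X,d)$ with invariant metric, $\mathrm{Cone}_\omega(X)$ is the group of sequences $(x_n)$ in $X$ with $\limsup_n d(x_n,0)/n<\infty$, endowed with the pseudo-distance $d_\omega(x,y)=\lim_\omega\frac1nd(x_n,y_n)$, modulo the subgroup of elements at pseudo-distance $0$ from the identity; it is a group with a bi-invariant distance, hence a topological group. A metric space is proper if its closed bounded subsets are compact. For a cardinal $\kappa$, $\mathbf{F}_p^{(\kappa)}$ is the direct sum of $\kappa$ copies of the cyclic group $\mathbf{F}_p$, with the discrete topology. For a topological group $H$, $H^\kappa$ is the product of $\kappa$ copies of $H$ with the product topology ($\mathbf{F}_p$ being discrete). *)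

theory Defs
  imports "HOL-Analysis.Analysis" "HOL-Algebra.Product_Groups"
begin

section \<open>Ultrafilters\<close>

text \<open>Filters on a set \<open>A\<close> are identified with filters on the ambient type that contain \<open>A\<close>.\<close>

definition ultrafilter_on :: "'a set \<Rightarrow> 'a filter \<Rightarrow> bool" where
  "ultrafilter_on A \<omega> \<longleftrightarrow>
     \<omega> \<noteq> bot \<and> (\<forall>\<^sub>F x in \<omega>. x \<in> A) \<and>
     (\<forall>P. (\<forall>\<^sub>F x in \<omega>. P x) \<or> (\<forall>\<^sub>F x in \<omega>. \<not> P x))"

definition nonprincipal :: "'a filter \<Rightarrow> bool" where
  "nonprincipal \<omega> \<longleftrightarrow> (\<forall>a. \<omega> \<noteq> principal {a})"


section \<open>Asymptotic cones of metric abelian groups\<close>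

text \<open>
  A metric abelian group is a group \<open>X\<close> (written multiplicatively, as always in HOL-Algebra, so
  that the zero element is \<open>\<one>\<^bsub>X\<^esub>\<close>) with an invariant distance \<open>d\<close> on its carrier. Sequences are
  indexed by the positive integers; being elements of \<open>product_group {1..} _\<close> they take the
  value \<open>undefined\<close> at 0, which affects neither the upper limit nor the limit along \<open>\<omega>\<close> below.
\<close>

definition linear_seqs :: "('a, 'm) monoid_scheme \<Rightarrow> ('a \<Rightarrow> 'a \<Rightarrow> real) \<Rightarrow> (nat \<Rightarrow> 'a) monoid" where
  "linear_seqs X d =
     (product_group {1..} (\<lambda>_. X))
       \<lparr>carrier := {x \<in> {1..} \<rightarrow>\<^sub>E carrier X. limsup (\<lambda>n. ereal (d (x n) \<one>\<^bsub>X\<^esub> / real n)) < \<infinity>}\<rparr>"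

definition cone_pseudodist ::
  "nat filter \<Rightarrow> ('a \<Rightarrow> 'a \<Rightarrow> real) \<Rightarrow> (nat \<Rightarrow> 'a) \<Rightarrow> (nat \<Rightarrow> 'a) \<Rightarrow> real" where
  "cone_pseudodist \<omega> d x y = Lim \<omega> (\<lambda>n. d (x n) (y n) / real n)"

definition null_seqs ::
  "nat filter \<Rightarrow> ('a, 'm) monoid_scheme \<Rightarrow> ('a \<Rightarrow> 'a \<Rightarrow> real) \<Rightarrow> (nat \<Rightarrow> 'a) set" where
  "null_seqs \<omega> X d =
     {x \<in> carrier (linear_seqs X d). cone_pseudodist \<omega> d x \<one>\<^bsub>linear_seqs X d\<^esub> = 0}"

definition asymp_cone ::
  "nat filter \<Rightarrow> ('a, 'm) monoid_scheme \<Rightarrow> ('a \<Rightarrow> 'a \<Rightarrow> real) \<Rightarrow> (nat \<Rightarrow> 'a) set monoid" where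
  "asymp_cone \<omega> X d = linear_seqs X d Mod null_seqs \<omega> X d"

text \<open>The elements of the cone are cosets; the pseudo-distance of two representatives depends
  only on their cosets, so that the image below is a singleton. The value 0 outside the carrier is
  there because \<^locale>\<open>Metric_space\<close> asks for symmetry and nonnegativity on the whole type.\<close>

definition cone_dist ::
  "nat filter \<Rightarrow> ('a, 'm) monoid_scheme \<Rightarrow> ('a \<Rightarrow> 'a \<Rightarrow> real)
     \<Rightarrow> (nat \<Rightarrow> 'a) set \<Rightarrow> (nat \<Rightarrow> 'a) set \<Rightarrow> real" where
  "cone_dist \<omega> X d A B =
     (if A \<in> carrier (asymp_cone \<omega> X d) \<and> B \<in> carrier (asymp_cone \<omega> X d)
      then the_elem ((\<lambda>(x, y). cone_pseudodist \<omega> d x y) ` (A \<times> B)) else 0)"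


section \<open>The groups $\mathbf{F}_p^{(J)}$\<close>

abbreviation Fp :: "nat \<Rightarrow> int monoid" where
  "Fp p \<equiv> integer_mod_group p"

abbreviation Fsum_pos :: "nat \<Rightarrow> (nat \<Rightarrow> int) monoid" where
  "Fsum_pos p \<equiv> sum_group {1..} (\<lambda>_. Fp p)"

text \<open>The set is finite for \<open>u\<close> in the direct sum, and the supremum of the empty set of naturals
  is 0.\<close>

definition supp_length :: "(nat \<Rightarrow> int) \<Rightarrow> nat" where
  "supp_length u = Sup {n \<in> {1..}. u n \<noteq> 0}"

definition Fdist :: "nat \<Rightarrow> (nat \<Rightarrow> int) \<Rightarrow> (nat \<Rightarrow> int) \<Rightarrow> real" where
  "Fdist p u v = real (supp_length (u \<otimes>\<^bsub>Fsum_pos p\<^esub> inv\<^bsub>Fsum_pos p\<^esub> v))"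

definition Fsum :: "nat \<Rightarrow> nat set \<Rightarrow> (nat \<Rightarrow> int) monoid" where
  "Fsum p J = (Fsum_pos p)\<lparr>carrier := {u \<in> carrier (Fsum_pos p). \<forall>n\<in>{1..} - J. u n = 0}\<rparr>"


section \<open>Proper metric spaces\<close>

definition proper_space :: "'a set \<Rightarrow> ('a \<Rightarrow> 'a \<Rightarrow> real) \<Rightarrow> bool" where
  "proper_space M d \<longleftrightarrow>
     (\<forall>S. closedin (Metric_space.mtopology M d) S \<and> Metric_space.mbounded M d S
        \<longrightarrow> compactin (Metric_space.mtopology M d) S)"


section \<open>Topological groups\<close>

text \<open>A topological group is given as a pair of a group and a topology on its carrier.\<close>

type_synonym 'a topgroup = "'a monoid \<times> 'a topology"

definition topgroup_iso :: "'a topgroup \<Rightarrow> 'b topgroup \<Rightarrow> bool"  (infix \<open>\<simeq>\<^sub>t\<close> 50) where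
  "G \<simeq>\<^sub>t H \<longleftrightarrow> (\<exists>f. f \<in> iso (fst G) (fst H) \<and> homeomorphic_map (snd G) (snd H) f)"

definition discrete_group :: "'a monoid \<Rightarrow> 'a topgroup" where
  "discrete_group G = (G, discrete_topology (carrier G))"

definition power_group :: "'a topgroup \<Rightarrow> 'i set \<Rightarrow> ('i \<Rightarrow> 'a) topgroup" where
  "power_group H I = (product_group I (\<lambda>_. fst H), product_topology (\<lambda>_. snd H) I)"

definition times_group :: "'a topgroup \<Rightarrow> 'b topgroup \<Rightarrow> ('a \<times> 'b) topgroup"  (infixr \<open>\<times>\<^sub>t\<close> 80) where
  "G \<times>\<^sub>t H = (fst G \<times>\<times> fst H, prod_topology (snd G) (snd H))"

text \<open>\<open>Fprod p I\<close> and \<open>Fdsum p I\<close> are the product (with the product topology) and the direct sum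
  (discrete) of copies of the discrete group of order \<open>p\<close>, indexed by \<open>I\<close>.\<close>

definition Fprod :: "nat \<Rightarrow> 'i set \<Rightarrow> ('i \<Rightarrow> int) topgroup" where
  "Fprod p I = power_group (discrete_group (Fp p)) I"

definition Fdsum :: "nat \<Rightarrow> 'i set \<Rightarrow> ('i \<Rightarrow> int) topgroup" where
  "Fdsum p I = discrete_group (sum_group I (\<lambda>_. Fp p))"

text \<open>Index sets realising the cardinals $\epsilon_0$ and $\epsilon_1 = 2^{\epsilon_0}$.\<close>

abbreviation eps0 :: "nat set" where
  "eps0 \<equiv> UNIV"

abbreviation eps1 :: "nat set set" where
  "eps1 \<equiv> Pow eps0"

end

theory Submission
  imports Defs "HOL-Algebra.Free_Abelian_Groups" "HOL-Number_Theory.Cong"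
begin

text \<open>
  The cone is an abelian group of exponent \<open>p\<close>, hence a vector space over the field with
  \<open>p\<close> elements, with an invariant ultrametric. So its closed balls of positive
  radius around the neutral element are open subgroups. Like every asymptotic cone it is complete, by a diagonal argument
  (\<open>complete_C\<close>).

  Choose a decreasing sequence of such balls shrinking to the neutral element, preceded by the whole
  group. By linear algebra each layer, that is the quotient of one term by the next, is a direct sum of
  copies of the group of order \<open>p\<close>, and a projection to it can be extended to the whole group
  (\<open>coordinate_map_exists\<close>). Completeness shows that the group is, as a topological group, the
  product of its discrete layers (\<open>product_decomposition\<close>). It remains to determine the
  dimensions of the layers for a suitable choice of the radii.

  Finite dimension of all layers below a ball is equivalent to compactness of that ball, since it
  amounts to total boundedness (\<open>compact_imp_finite_indep\<close>, \<open>noncompact_imp_infinite_indep\<close>).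
  If a layer is infinite-dimensional, then, up to a slight change of the two radii, its dimension is
  exactly the continuum. It is not larger because a countable group has at most that many sequences.
  It is not smaller because an ultraproduct is countably saturated: from infinitely many independent
  elements one builds continuum many by following the branches of a binary tree
  (\<open>saturated_C\<close>).

  The cases of the theorem now differ only in the choice of the filtration. In the discrete case a
  ball is trivial and the group is the direct sum given by a basis. In the locally compact case one starts
  with a compact ball, below which all layers are finite; the quotient by the ball is the discrete
  factor, which is trivial if the ball is the whole compact cone, countable and infinite if the cone is
  proper and unbounded, and of continuum dimension if the cone is not proper. If no ball is compact, the radii can be chosen such that all layers have
  continuum dimension.
\<close>

section \<open>Bases of abelian groups of prime exponent\<close>

lemma carrier_Fsum_iff:
  assumes "0 < p"
  shows "c \<in> carrier (sum_group I (\<lambda>_. Fp p)) \<longleftrightarrow> c \<in> I \<rightarrow>\<^sub>E {0..<int p} \<and> finite {i \<in> I. c i \<noteq> 0}"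
  using assms by (simp add: carrier_sum_group carrier_integer_mod_group)

locale elementary_group = comm_group G for G (structure) +
  fixes p :: nat
  assumes prime_p: "Factorial_Ring.prime p"
    and exponent: "x \<in> carrier G \<Longrightarrow> x [^] p = \<one>"
begin

lemma p_pos: "0 < p"
  using prime_p by (simp add: prime_gt_0_nat)

lemmas carrier_Fsum = carrier_Fsum_iff[OF p_pos]

lemma pow_mod: "x \<in> carrier G \<Longrightarrow> x [^] (k mod int p) = x [^] (k::int)"
proof -
  assume x: "x \<in> carrier G"
  have "x [^] k = x [^] (int p * (k div int p) + k mod int p)" by simp
  also have "\<dots> = (x [^] int p) [^] (k div int p) \<otimes> x [^] (k mod int p)"
    using x by (simp only: int_pow_mult int_pow_pow)
  also have "\<dots> = x [^] (k mod int p)"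
    using x exponent[OF x] by (simp add: int_pow_int)
  finally show ?thesis by simp
qed

text \<open>The coefficients are integers, but by the exponent they only matter modulo \<open>p\<close>; on
  \<open>sum_group I (\<lambda>_. Fp p)\<close> the map is a homomorphism, the linear map from the space with basis
  \<open>I\<close> that sends the basis vector \<open>i\<close> to \<open>f i\<close>.\<close>

definition lincomb :: "('i \<Rightarrow> 'a) \<Rightarrow> 'i set \<Rightarrow> ('i \<Rightarrow> int) \<Rightarrow> 'a" where
  "lincomb f I c = gfinprod G (\<lambda>i. f i [^] c i) I"

lemma lincomb_hom: "f \<in> I \<rightarrow> carrier G \<Longrightarrow> lincomb f I \<in> hom (sum_group I (\<lambda>_. Fp p)) G"
  unfolding lincomb_def
  by (rule hom_group_sum) (auto intro!: homI simp: pow_mod Pi_iff int_pow_mult)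

lemma lincomb_closed:
  "\<lbrakk>f \<in> I \<rightarrow> carrier G; c \<in> carrier (sum_group I (\<lambda>_. Fp p))\<rbrakk> \<Longrightarrow> lincomb f I c \<in> carrier G"
  using hom_in_carrier lincomb_hom by metis

lemma lincomb_eq_finprod:
  assumes "f \<in> I \<rightarrow> carrier G" "finite F" "F \<subseteq> I" "\<And>i. i \<in> I - F \<Longrightarrow> c i = 0"
  shows "lincomb f I c = (\<Otimes>i\<in>F. f i [^] c i)"
proof -
  have "lincomb f I c = gfinprod G (\<lambda>i. f i [^] c i) F"
    unfolding lincomb_def
    by (rule gfinprod_mono_neutral_cong_right) (use assms in auto)
  also have "\<dots> = (\<Otimes>i\<in>F. f i [^] c i)"
    by (rule gfinprod_eq_finprod) (use assms in auto)
  finally show ?thesis .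
qed

text \<open>Linear independence of the images of the family \<open>f\<close> in the quotient by \<open>W\<close>, spelled
  out with finite combinations so that no quotient group is needed. Families, rather than sets only,
  are convenient for the diagonal construction of large independent sets; a set \<open>B\<close> is the
  family \<open>\<lambda>b. b\<close> on \<open>B\<close>.\<close>

definition indep :: "'a set \<Rightarrow> ('i \<Rightarrow> 'a) \<Rightarrow> 'i set \<Rightarrow> bool" where
  "indep W f I \<longleftrightarrow> f \<in> I \<rightarrow> carrier G \<and>
     (\<forall>F c. finite F \<and> F \<subseteq> I \<and> c \<in> F \<rightarrow> {0..<int p} \<and> (\<Otimes>i\<in>F. f i [^] c i) \<in> W \<longrightarrow> (\<forall>i\<in>F. c i = 0))"

lemma indepD:
  "\<lbrakk>indep W f I; finite F; F \<subseteq> I; c \<in> F \<rightarrow> {0..<int p}; (\<Otimes>i\<in>F. f i [^] c i) \<in> W; i \<in> F\<rbrakk> \<Longrightarrow> c i = 0"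
  unfolding indep_def by blast

lemma indep_in_carrier: "indep W f I \<Longrightarrow> f \<in> I \<rightarrow> carrier G"
  unfolding indep_def by blast

lemma indep_mono: "\<lbrakk>indep W f I; W' \<subseteq> W; J \<subseteq> I\<rbrakk> \<Longrightarrow> indep W' f J"
  unfolding indep_def Pi_iff by (meson order.trans subsetD)

lemma indep_lincomb:
  assumes "indep W f I" "c \<in> carrier (sum_group I (\<lambda>_. Fp p))" "lincomb f I c \<in> W"
  shows "c = \<one>\<^bsub>sum_group I (\<lambda>_. Fp p)\<^esub>"
proof -
  define F where "F = {i \<in> I. c i \<noteq> 0}"
  have F: "finite F" "F \<subseteq> I" "c \<in> F \<rightarrow> {0..<int p}" "c \<in> extensional I"
    using assms(2) by (auto simp: carrier_Fsum F_def PiE_iff)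
  have "lincomb f I c = (\<Otimes>i\<in>F. f i [^] c i)"
    by (rule lincomb_eq_finprod) (use indep_in_carrier[OF assms(1)] F in \<open>auto simp: F_def\<close>)
  then have "\<forall>i\<in>F. c i = 0"
    using indepD[OF assms(1) F(1-3)] assms(3) by auto
  then have "\<forall>i\<in>I. c i = 0" by (auto simp: F_def)
  then show ?thesis using F(4) by (auto simp: fun_eq_iff extensional_def)
qed

lemma indep_imp_inj:
  assumes "indep W f I" "subgroup W G"
  shows "inj_on f I"
proof (rule inj_onI, rule ccontr)
  fix i j assume ij: "i \<in> I" "j \<in> I" "f i = f j" "i \<noteq> j"
  \<comment> \<open>The combination that expresses the quotient of two equal elements: \<open>p - 1\<close> stands for \<open>-1\<close>.\<close>
  define c where "c = (\<lambda>k. if k = i then 1 else int p - 1)"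
  have p: "p \<ge> 2" using prime_p by (simp add: prime_ge_2_nat)
  have fi: "f i \<in> carrier G" using indep_in_carrier[OF assms(1)] ij by auto
  have "(\<Otimes>k\<in>{i,j}. f k [^] c k) = f i [^] c i \<otimes> f j [^] c j"
    using fi ij by simp
  also have "\<dots> = f i [^] int p"
    using ij fi by (simp add: c_def flip: int_pow_mult) (metis int_pow_1 int_pow_mult add.commute diff_add_cancel)
  also have "\<dots> = \<one>" using exponent[OF fi] by (simp add: int_pow_int)
  finally have "(\<Otimes>k\<in>{i,j}. f k [^] c k) \<in> W" using subgroup.one_closed[OF assms(2)] by simp
  then have "c i = 0"
    using indepD[OF assms(1), of "{i,j}" c i] ij p by (auto simp: c_def)
  then show False by (simp add: c_def)
qed

lemma indep_image:
  assumes "indep W f I" "subgroup W G"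
  shows "indep W (\<lambda>x. x) (f ` I)"
  unfolding indep_def
proof (intro conjI allI impI ballI)
  show "(\<lambda>x. x) \<in> f ` I \<rightarrow> carrier G" using indep_in_carrier[OF assms(1)] by auto
  fix F c x assume H: "finite F \<and> F \<subseteq> f ` I \<and> c \<in> F \<rightarrow> {0..<int p} \<and> (\<Otimes>i\<in>F. i [^] c i) \<in> W"
    and x: "x \<in> F"
  obtain F' where F': "F' \<subseteq> I" "finite F'" "F = f ` F'"
    using H by (meson finite_subset_image)
  have inj: "inj_on f F'" using indep_imp_inj[OF assms] F' inj_on_subset by blast
  have "(\<Otimes>i\<in>F. i [^] c i) = (\<Otimes>i\<in>F'. f i [^] c (f i))"
    unfolding F'(3) by (rule finprod_reindex[OF _ inj]) (use F' indep_in_carrier[OF assms(1)] in auto)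
  then have "(\<Otimes>i\<in>F'. f i [^] (c \<circ> f) i) \<in> W" using H by simp
  moreover have "c \<circ> f \<in> F' \<rightarrow> {0..<int p}" using H F' by auto
  moreover obtain i where "i \<in> F'" "x = f i" using x F' by blast
  ultimately show "c x = 0" using indepD[OF assms(1) F'(2,1), of "c \<circ> f" i] by simp
qed

lemma indep_reindex:
  assumes "indep W f (h ` I)" "inj_on h I"
  shows "indep W (f \<circ> h) I"
  unfolding indep_def
proof (intro conjI allI impI ballI)
  show "f \<circ> h \<in> I \<rightarrow> carrier G" using indep_in_carrier[OF assms(1)] by auto
  fix F c i assume H: "finite F \<and> F \<subseteq> I \<and> c \<in> F \<rightarrow> {0..<int p} \<and> (\<Otimes>i\<in>F. (f \<circ> h) i [^] c i) \<in> W"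
    and i: "i \<in> F"
  have inj: "inj_on h F" using assms(2) H inj_on_subset by blast
  define c' where "c' = c \<circ> inv_into F h"
  have c': "c' (h j) = c j" if "j \<in> F" for j using that inj by (simp add: c'_def)
  have "(\<Otimes>j\<in>h ` F. f j [^] c' j) = (\<Otimes>j\<in>F. f (h j) [^] c' (h j))"
    by (rule finprod_reindex[OF _ inj]) (use H indep_in_carrier[OF assms(1)] in \<open>auto simp: Pi_iff subset_iff\<close>)
  also have "\<dots> = (\<Otimes>j\<in>F. (f \<circ> h) j [^] c j)"
    by (rule finprod_cong) (use H indep_in_carrier[OF assms(1)] c' in \<open>auto simp: simp_implies_def Pi_iff subset_iff\<close>)
  finally have "c' (h i) = 0"
    using indepD[OF assms(1), of "h ` F" c' "h i"] H i c' by (auto simp: Pi_iff)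
  then show "c i = 0" using c' i by simp
qed

text \<open>The preimage in the group of the span of \<open>B\<close> in the quotient by \<open>W\<close>.\<close>

definition span :: "'a set \<Rightarrow> 'a set \<Rightarrow> 'a set" where
  "span W B = {x \<in> carrier G. \<exists>c \<in> carrier (sum_group B (\<lambda>_. Fp p)). x \<otimes> inv (lincomb (\<lambda>b. b) B c) \<in> W}"

lemma subgroup_span:
  assumes W: "subgroup W G" and B: "B \<subseteq> carrier G"
  shows "subgroup (span W B) G"
proof -
  interpret W: subgroup W G by (rule W)
  let ?S = "sum_group B (\<lambda>_. Fp p)"
  interpret S: group ?S by simp
  interpret L: group_hom ?S G "lincomb (\<lambda>b. b) B"
    by (unfold_locales) (rule lincomb_hom, use B in auto)
  show ?thesis
  proof
    show "span W B \<subseteq> carrier G" by (auto simp: span_def)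
    show "\<one> \<in> span W B"
      unfolding span_def using S.one_closed L.hom_one by (force simp del: one_sum_group)
    fix x y assume "x \<in> span W B"
    then obtain c where c: "x \<in> carrier G" "c \<in> carrier ?S" "x \<otimes> inv (lincomb (\<lambda>b. b) B c) \<in> W"
      by (auto simp: span_def)
    have "inv x \<otimes> inv (lincomb (\<lambda>b. b) B (inv\<^bsub>?S\<^esub> c)) = inv (x \<otimes> inv (lincomb (\<lambda>b. b) B c))"
      using c L.hom_inv[OF c(2)] L.hom_closed[OF c(2)] by (simp add: inv_mult del: inv_sum_group)
    then show "inv x \<in> span W B"
      unfolding span_def using c S.inv_closed W.m_inv_closed[OF c(3)] by (metis (mono_tags, lifting) inv_closed mem_Collect_eq)
    assume "y \<in> span W B"
    then obtain d where d: "y \<in> carrier G" "d \<in> carrier ?S" "y \<otimes> inv (lincomb (\<lambda>b. b) B d) \<in> W"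
      by (auto simp: span_def)
    have "(x \<otimes> y) \<otimes> inv (lincomb (\<lambda>b. b) B (c \<otimes>\<^bsub>?S\<^esub> d)) = (x \<otimes> inv (lincomb (\<lambda>b. b) B c)) \<otimes> (y \<otimes> inv (lincomb (\<lambda>b. b) B d))"
      using c d L.hom_mult[OF c(2) d(2)] L.hom_closed[OF c(2)] L.hom_closed[OF d(2)]
      by (simp add: inv_mult m_ac del: mult_sum_group)
    then show "x \<otimes> y \<in> span W B"
      unfolding span_def using c d S.m_closed[OF c(2) d(2)] W.m_closed[OF c(3) d(3)] by (metis (mono_tags, lifting) m_closed mem_Collect_eq)
  qed
qed

lemma subset_span: "\<lbrakk>subgroup W G; B \<subseteq> carrier G\<rbrakk> \<Longrightarrow> W \<subseteq> span W B"
proof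
  fix x assume W: "subgroup W G" and B: "B \<subseteq> carrier G" and x: "x \<in> W"
  let ?S = "sum_group B (\<lambda>_. Fp p)"
  interpret S: group ?S by simp
  interpret L: group_hom ?S G "lincomb (\<lambda>b. b) B"
    by (unfold_locales) (rule lincomb_hom, use B in auto)
  have xc: "x \<in> carrier G" using W x subgroup.subset by blast
  have "x \<otimes> inv (lincomb (\<lambda>b. b) B \<one>\<^bsub>?S\<^esub>) \<in> W" using L.hom_one xc x by (simp del: one_sum_group)
  then show "x \<in> span W B" unfolding span_def using S.one_closed xc by blast
qed

lemma generators_in_span:
  assumes "subgroup W G" "B \<subseteq> carrier G" "b \<in> B"
  shows "b \<in> span W B"
proof -
  define c where "c = (\<lambda>i\<in>B. if i = b then 1 else 0 :: int)"
  have p: "p \<ge> 2" using prime_p by (simp add: prime_ge_2_nat)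
  have c: "c \<in> carrier (sum_group B (\<lambda>_. Fp p))"
    using p by (auto simp: carrier_Fsum c_def intro: rev_finite_subset[of "{b}"])
  have b: "b \<in> carrier G" using assms by auto
  have "lincomb (\<lambda>b. b) B c = (\<Otimes>i\<in>{b}. i [^] c i)"
    by (rule lincomb_eq_finprod) (use assms in \<open>auto simp: c_def\<close>)
  also have "\<dots> = b" using b assms(3) by (simp add: c_def)
  finally have "b \<otimes> inv (lincomb (\<lambda>b. b) B c) \<in> W" using b subgroup.one_closed[OF assms(1)] by simp
  then show ?thesis unfolding span_def using b c by blast
qed

lemma finprod_in_subgroup:
  assumes "subgroup H G" "finite F" "\<And>i. i \<in> F \<Longrightarrow> f i \<in> H"
  shows "(\<Otimes>i\<in>F. f i) \<in> H"
proof -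
  have H: "H \<subseteq> carrier G" using assms(1) by (rule subgroup.subset)
  show ?thesis using assms(2,3)
  proof (induction F rule: finite_induct)
    case empty then show ?case using subgroup.one_closed[OF assms(1)] by simp
  next
    case (insert x F)
    then show ?case using subgroup.m_closed[OF assms(1)] H
      by (subst finprod_insert) (auto simp: Pi_iff)
  qed
qed

text \<open>The step of linear algebra over a field: if a combination with nonzero coefficient
  \<open>k\<close> at \<open>x\<close> lies in \<open>W\<close>, then \<open>x\<close> to the power \<open>k\<close> lies in the span, and
  since \<open>k\<close> is invertible modulo the prime \<open>p\<close> so does \<open>x\<close> itself.\<close>

lemma indep_insert:
  assumes W: "subgroup W G" and ind: "indep W (\<lambda>b. b) B" and x: "x \<in> carrier G" "x \<notin> span W B"
  shows "indep W (\<lambda>b. b) (insert x B)"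
  unfolding indep_def
proof (intro conjI allI impI)
  have B: "B \<subseteq> carrier G" using indep_in_carrier[OF ind] by auto
  have S: "subgroup (span W B) G" using subgroup_span[OF W B] .
  show "(\<lambda>b. b) \<in> insert x B \<rightarrow> carrier G" using B x by auto
  fix F c assume H: "finite F \<and> F \<subseteq> insert x B \<and> c \<in> F \<rightarrow> {0..<int p} \<and> (\<Otimes>i\<in>F. i [^] c i) \<in> W"
  define F' where "F' = F - {x}"
  have F': "finite F'" "F' \<subseteq> B" "c \<in> F' \<rightarrow> {0..<int p}" "F' \<subseteq> carrier G" using H B by (auto simp: F'_def)
  show "\<forall>i\<in>F. c i = 0"
  proof (cases "x \<in> F")
    case False
    then show ?thesis using indepD[OF ind, of F c] H by blast
  next
    case True
    then have F: "F = insert x F'" "x \<notin> F'" by (auto simp: F'_def)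
    define y where "y = (\<Otimes>i\<in>F'. i [^] c i)"
    have y: "y \<in> span W B" unfolding y_def
      by (rule finprod_in_subgroup[OF S F'(1)])
        (use F' generators_in_span[OF W B] subgroup_int_pow_closed[OF S] in auto)
    have yc: "y \<in> carrier G" using y by (auto simp: span_def)
    have prod: "x [^] c x \<otimes> y \<in> W"
      using H F F' x by (simp add: y_def Pi_iff subset_iff)
    have "c x = 0"
    proof (rule ccontr)
      assume "c x \<noteq> 0"
      then have "0 < c x" "c x < int p" using H True by (auto simp: Pi_iff)
      then have "coprime (c x) (int p)"
        using prime_p by (metis coprime_commute prime_imp_coprime prime_nat_int_transfer zdvd_imp_le linorder_not_less)
      then obtain k where k: "[c x * k = 1] (mod int p)" by (meson cong_solve_coprime_int)
      have "x [^] c x = (x [^] c x \<otimes> y) \<otimes> inv y" using x yc by (simp add: m_assoc)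
      then have "x [^] c x \<in> span W B"
        using prod y subset_span[OF W B] subgroup.m_closed[OF S] subgroup.m_inv_closed[OF S] by (metis subsetD)
      then have "(x [^] c x) [^] k \<in> span W B" by (rule subgroup_int_pow_closed[OF S])
      moreover have "(x [^] c x) [^] k = x [^] (c x * k)" using x by (simp add: int_pow_pow)
      moreover have "x [^] (c x * k) = x [^] (1::int)"
        using pow_mod[OF x(1), of "c x * k"] pow_mod[OF x(1), of 1] k by (simp add: cong_def)
      ultimately show False using x by simp
    qed
    moreover from this have "y \<in> W" using prod yc by simp
    then have "\<forall>i\<in>F'. c i = 0" using indepD[OF ind F'(1-3)] by (auto simp: y_def)
    ultimately show ?thesis using F by auto
  qed
qed

text \<open>Zorn's lemma. Independence only involves finite subsets, so it passes to unions of
  chains, and a maximal independent set spans.\<close>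

lemma basis_extension:
  assumes W: "subgroup W G" and U: "subgroup U G" and A: "A \<subseteq> U" "indep W (\<lambda>b. b) A"
  obtains B where "A \<subseteq> B" "B \<subseteq> U" "indep W (\<lambda>b. b) B" "U \<subseteq> span W B"
proof -
  let ?C = "{B. A \<subseteq> B \<and> B \<subseteq> U \<and> indep W (\<lambda>b. b) B}"
  have "\<exists>M\<in>?C. \<forall>X\<in>?C. M \<subseteq> X \<longrightarrow> X = M"
  proof (rule subset_Zorn_nonempty)
    show "?C \<noteq> {}" using A by blast
    fix \<C> assume ne: "\<C> \<noteq> {}" and chain: "subset.chain ?C \<C>"
    have sub: "\<C> \<subseteq> ?C" and tot: "\<And>X Y. X \<in> \<C> \<Longrightarrow> Y \<in> \<C> \<Longrightarrow> X \<subseteq> Y \<or> Y \<subseteq> X"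
      using chain by (auto simp: subset_chain_def)
    have "indep W (\<lambda>b. b) (\<Union>\<C>)"
      unfolding indep_def
    proof (intro conjI allI impI)
      show "(\<lambda>b. b) \<in> \<Union>\<C> \<rightarrow> carrier G" using sub subgroup.subset[OF U] by auto
      fix F c assume H: "finite F \<and> F \<subseteq> \<Union>\<C> \<and> c \<in> F \<rightarrow> {0..<int p} \<and> (\<Otimes>i\<in>F. i [^] c i) \<in> W"
      then obtain M where "M \<in> \<C>" "F \<subseteq> M"
        by (metis (no_types, lifting) finite_subset_Union_chain[OF _ _ ne chain])
      then have "indep W (\<lambda>b. b) M" using sub by blast
      then show "\<forall>i\<in>F. c i = 0" using indepD[of W "\<lambda>b. b" M F c] \<open>F \<subseteq> M\<close> H by simp
    qed
    then show "\<Union>\<C> \<in> ?C" using sub ne by blast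
  qed
  then obtain B where "B \<in> ?C" and max: "\<forall>X\<in>?C. B \<subseteq> X \<longrightarrow> X = B" by (rule bexE)
  then have B: "A \<subseteq> B" "B \<subseteq> U" "indep W (\<lambda>b. b) B" by simp_all
  have "x \<in> span W B" if x: "x \<in> U" for x
  proof (rule ccontr)
    assume n: "x \<notin> span W B"
    have xc: "x \<in> carrier G" using x subgroup.subset[OF U] by auto
    have "insert x B \<in> ?C" using indep_insert[OF W B(3) xc n] B x by simp blast
    then have "insert x B = B" using max by (metis subset_insertI)
    then have "x \<in> B" by auto
    then show False using n generators_in_span[OF W] B subgroup.subset[OF U] by blast
  qed
  then show thesis using that B by blast
qed

text \<open>A coordinate map describes the quotient of \<open>U\<close> by \<open>W\<close> in terms of a basis
  indexed by \<open>I\<close>. It is required to be defined, as a homomorphism, on the whole group and not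
  only on \<open>U\<close>: this is what makes it possible to put the coordinate maps of all steps of a
  filtration together into one map.\<close>

definition coordinate_map :: "'a set \<Rightarrow> 'a set \<Rightarrow> 'i set \<Rightarrow> ('a \<Rightarrow> 'i \<Rightarrow> int) \<Rightarrow> bool" where
  "coordinate_map W U I \<phi> \<longleftrightarrow>
     \<phi> \<in> hom G (sum_group I (\<lambda>_. Fp p)) \<and> \<phi> ` U = carrier (sum_group I (\<lambda>_. Fp p)) \<and>
     (\<forall>x\<in>W. \<phi> x = \<one>\<^bsub>sum_group I (\<lambda>_. Fp p)\<^esub>) \<and>
     (\<forall>x\<in>U. \<phi> x = \<one>\<^bsub>sum_group I (\<lambda>_. Fp p)\<^esub> \<longrightarrow> x \<in> W)"

text \<open>A basis \<open>B\<close> of \<open>U\<close> modulo \<open>W\<close> is extended to a basis \<open>E\<close> of the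
  whole group modulo \<open>W\<close>; forgetting the coordinates outside \<open>B\<close> then gives a map defined
  everywhere. Since \<open>A\<close> can be prescribed, an independent set of known size yields a lower bound
  for the size of the basis.\<close>

lemma coordinate_map_exists:
  assumes W: "subgroup W G" and U: "subgroup U G" and A: "A \<subseteq> U" "indep W (\<lambda>b. b) A"
  obtains B \<phi> where "A \<subseteq> B" "B \<subseteq> U" "indep W (\<lambda>b. b) B" "U \<subseteq> span W B" "coordinate_map W U B \<phi>"
proof -
  interpret W: subgroup W G by (rule W)
  obtain B where B: "A \<subseteq> B" "B \<subseteq> U" "indep W (\<lambda>b. b) B" "U \<subseteq> span W B"
    using basis_extension[OF W U A] by blast
  have Uc: "U \<subseteq> carrier G" using U by (rule subgroup.subset)
  obtain E where E: "B \<subseteq> E" "E \<subseteq> carrier G" "indep W (\<lambda>b. b) E" "carrier G \<subseteq> span W E"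
    using basis_extension[OF W subgroup_self _ B(3)] B(2) Uc by blast
  let ?S = "sum_group B (\<lambda>_. Fp p)" and ?T = "sum_group E (\<lambda>_. Fp p)"
  let ?L = "lincomb (\<lambda>b. b) B" and ?M = "lincomb (\<lambda>b. b) E"
  interpret S: group ?S by simp
  interpret T: group ?T by simp
  interpret M: group_hom ?T G ?M
    by (unfold_locales) (rule lincomb_hom, use E in auto)
  have M_eqI: "c = d" if "c \<in> carrier ?T" "d \<in> carrier ?T" "?M c \<otimes> inv (?M d) \<in> W" for c d
  proof -
    have "?M (c \<otimes>\<^bsub>?T\<^esub> inv\<^bsub>?T\<^esub> d) \<in> W"
      using that M.hom_mult M.hom_inv by (simp del: mult_sum_group inv_sum_group)
    then have "c \<otimes>\<^bsub>?T\<^esub> inv\<^bsub>?T\<^esub> d = \<one>\<^bsub>?T\<^esub>"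
      using indep_lincomb[OF E(3)] that by (simp del: mult_sum_group inv_sum_group one_sum_group)
    then show ?thesis
      using that T.inv_solve_right by (metis T.inv_closed T.inv_equality T.inv_inv)
  qed
  have ex1: "\<exists>!c. c \<in> carrier ?T \<and> x \<otimes> inv (?M c) \<in> W" if x: "x \<in> carrier G" for x
  proof (rule ex_ex1I)
    show "\<exists>c. c \<in> carrier ?T \<and> x \<otimes> inv (?M c) \<in> W" using E(4) x unfolding span_def by blast
    fix c d assume c: "c \<in> carrier ?T \<and> x \<otimes> inv (?M c) \<in> W" and d: "d \<in> carrier ?T \<and> x \<otimes> inv (?M d) \<in> W"
    have cl: "?M c \<in> carrier G" "?M d \<in> carrier G" using c d by auto
    have "inv (x \<otimes> inv (?M c)) \<otimes> (x \<otimes> inv (?M d)) = (inv x \<otimes> x) \<otimes> (?M c \<otimes> inv (?M d))"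
      using x cl by (simp only: inv_mult inv_inv m_ac inv_closed m_closed)
    also have "\<dots> = ?M c \<otimes> inv (?M d)" using x cl by simp
    finally have "inv (x \<otimes> inv (?M c)) \<otimes> (x \<otimes> inv (?M d)) = ?M c \<otimes> inv (?M d)" .
    then have "?M c \<otimes> inv (?M d) \<in> W" using c d W.m_closed W.m_inv_closed by metis
    then show "c = d" using M_eqI c d by blast
  qed
  define \<kappa> where "\<kappa> x = (THE c. c \<in> carrier ?T \<and> x \<otimes> inv (?M c) \<in> W)" for x
  have \<kappa>: "\<kappa> x \<in> carrier ?T" "x \<otimes> inv (?M (\<kappa> x)) \<in> W" if "x \<in> carrier G" for x
    using theI'[OF ex1[OF that]] by (auto simp: \<kappa>_def)
  have \<kappa>_eq: "\<kappa> x = c" if "x \<in> carrier G" "c \<in> carrier ?T" "x \<otimes> inv (?M c) \<in> W" for x c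
    using ex1[OF that(1)] \<kappa>[OF that(1)] that by blast
  have \<kappa>_mult: "\<kappa> (x \<otimes> y) = \<kappa> x \<otimes>\<^bsub>?T\<^esub> \<kappa> y" if x: "x \<in> carrier G" and y: "y \<in> carrier G" for x y
  proof (rule \<kappa>_eq)
    have "x \<otimes> y \<otimes> inv (?M (\<kappa> x \<otimes>\<^bsub>?T\<^esub> \<kappa> y)) = (x \<otimes> inv (?M (\<kappa> x))) \<otimes> (y \<otimes> inv (?M (\<kappa> y)))"
      using \<kappa>[OF x] \<kappa>[OF y] x y M.hom_mult M.hom_closed by (simp add: inv_mult m_ac del: mult_sum_group)
    then show "x \<otimes> y \<otimes> inv (?M (\<kappa> x \<otimes>\<^bsub>?T\<^esub> \<kappa> y)) \<in> W" using \<kappa>[OF x] \<kappa>[OF y] W.m_closed by metis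
  qed (use x y \<kappa> in \<open>auto simp del: mult_sum_group\<close>)
  define \<phi> where "\<phi> x = restrict (\<kappa> x) B" for x
  have hom: "\<phi> \<in> hom G ?S"
  proof (rule homI)
    show "\<phi> x \<in> carrier ?S" if "x \<in> carrier G" for x
      using \<kappa>(1)[OF that] E(1) unfolding \<phi>_def carrier_Fsum
      by (auto simp: PiE_iff elim: rev_finite_subset)
    show "\<phi> (x \<otimes> y) = \<phi> x \<otimes>\<^bsub>?S\<^esub> \<phi> y" if "x \<in> carrier G" "y \<in> carrier G" for x y
      using E(1) by (auto simp: \<phi>_def \<kappa>_mult[OF that] fun_eq_iff subset_iff)
  qed
  have zero: "\<phi> x = \<one>\<^bsub>?S\<^esub>" if "x \<in> W" for x
  proof -
    have "x \<in> carrier G" using that by auto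
    then have "\<kappa> x = \<one>\<^bsub>?T\<^esub>"
      by (intro \<kappa>_eq) (use that M.hom_one in \<open>auto simp del: one_sum_group\<close>)
    then show ?thesis using E(1) by (auto simp: \<phi>_def fun_eq_iff)
  qed
  \<comment> \<open>Extension by zero of coefficients on \<open>B\<close> to coefficients on \<open>E\<close>.\<close>
  define ext where "ext c = (\<lambda>i\<in>E. if i \<in> B then c i else 0 :: int)" for c
  have ext: "ext c \<in> carrier ?T" "?M (ext c) = ?L c" "restrict (ext c) B = c" if c: "c \<in> carrier ?S" for c
  proof -
    define F where "F = {i \<in> B. c i \<noteq> 0}"
    have F: "finite F" "F \<subseteq> B" "F \<subseteq> E" using c E(1) by (auto simp: carrier_Fsum F_def)
    have sup: "{i \<in> E. ext c i \<noteq> 0} = F" using E(1) by (auto simp: F_def ext_def)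
    show "ext c \<in> carrier ?T"
      unfolding carrier_Fsum sup using c F p_pos by (auto simp: carrier_Fsum ext_def PiE_iff)
    have "?L c = (\<Otimes>i\<in>F. i [^] c i)"
      by (rule lincomb_eq_finprod) (use F B Uc in \<open>auto simp: F_def\<close>)
    also have "\<dots> = (\<Otimes>i\<in>F. i [^] ext c i)"
      by (rule finprod_cong) (use F E in \<open>auto simp: ext_def simp_implies_def\<close>)
    also have "\<dots> = ?M (ext c)"
      by (rule lincomb_eq_finprod[symmetric]) (use F E sup in auto)
    finally show "?M (ext c) = ?L c" by simp
    show "restrict (ext c) B = c" using c E(1) by (auto simp: ext_def fun_eq_iff carrier_Fsum PiE_iff extensional_def)
  qed
  have \<phi>_ext: "\<phi> x = c" "\<kappa> x = ext c" if "x \<in> carrier G" "c \<in> carrier ?S" "x \<otimes> inv (?L c) \<in> W" for x c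
  proof -
    show "\<kappa> x = ext c" by (rule \<kappa>_eq) (use that ext in auto)
    then show "\<phi> x = c" using ext that by (simp add: \<phi>_def)
  qed
  have rep: "\<exists>c\<in>carrier ?S. x \<otimes> inv (?L c) \<in> W" if "x \<in> U" for x
    using B(4) that unfolding span_def by blast
  have onto: "\<phi> ` U = carrier ?S"
  proof
    show "\<phi> ` U \<subseteq> carrier ?S" using hom Uc by (auto simp: hom_def)
    show "carrier ?S \<subseteq> \<phi> ` U"
    proof
      fix c assume c: "c \<in> carrier ?S"
      have idB: "(\<lambda>b. b) \<in> B \<rightarrow> carrier G" using B Uc by auto
      have Lc: "?L c \<in> carrier G" using lincomb_closed[OF idB c] .
      have "?L c = (\<Otimes>i\<in>{i\<in>B. c i \<noteq> 0}. i [^] c i)"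
        by (rule lincomb_eq_finprod) (use c idB in \<open>auto simp: carrier_Fsum\<close>)
      also have "\<dots> \<in> U"
        by (rule finprod_in_subgroup[OF U]) (use c B subgroup_int_pow_closed[OF U] in \<open>auto simp: carrier_Fsum\<close>)
      finally have "?L c \<in> U" .
      moreover have "\<phi> (?L c) = c" by (rule \<phi>_ext) (use Lc c in auto)
      ultimately show "c \<in> \<phi> ` U" by force
    qed
  qed
  have ker: "x \<in> W" if x: "x \<in> U" "\<phi> x = \<one>\<^bsub>?S\<^esub>" for x
  proof -
    obtain c where c: "c \<in> carrier ?S" "x \<otimes> inv (?L c) \<in> W" using rep x by blast
    then have "c = \<one>\<^bsub>?S\<^esub>" using \<phi>_ext(1)[of x c] x Uc by auto
    moreover have "?L \<one>\<^bsub>?S\<^esub> = \<one>"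
      by (rule hom_one[OF lincomb_hom S.is_group is_group]) (use B Uc in auto)
    ultimately show ?thesis using c x Uc by (auto simp del: one_sum_group)
  qed
  have "coordinate_map W U B \<phi>"
    unfolding coordinate_map_def using hom onto zero ker by simp
  then show thesis by (rule that[OF B])
qed

end

section \<open>Complete ultrametric groups\<close>

locale ultrametric_group =
  elementary_group G p + Metric_space "carrier G" D
  for G :: "'a monoid" (structure) and p :: nat and D :: "'a \<Rightarrow> 'a \<Rightarrow> real" +
  assumes invariant:
      "\<lbrakk>x \<in> carrier G; y \<in> carrier G; z \<in> carrier G\<rbrakk> \<Longrightarrow> D (x \<otimes> z) (y \<otimes> z) = D x y"
    and ultrametric:
      "\<lbrakk>x \<in> carrier G; y \<in> carrier G; z \<in> carrier G\<rbrakk> \<Longrightarrow> D x z \<le> max (D x y) (D y z)"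
    and complete: "mcomplete"
begin

text \<open>The closed balls around the neutral element. Since the distance is an invariant
  ultrametric, they are subgroups, and they form a basis of neighbourhoods.\<close>

definition V :: "real \<Rightarrow> 'a set" where
  "V r = {x \<in> carrier G. D x \<one> \<le> r}"

lemma V_subset: "V r \<subseteq> carrier G" by (auto simp: V_def)

lemma V_mono: "r \<le> s \<Longrightarrow> V r \<subseteq> V s" by (auto simp: V_def)

lemma dist_quotient: "\<lbrakk>x \<in> carrier G; y \<in> carrier G\<rbrakk> \<Longrightarrow> D (x \<otimes> inv y) \<one> = D x y"
  using invariant[of x y "inv y"] by simp

lemma quotient_in_V_iff:
  "\<lbrakk>x \<in> carrier G; y \<in> carrier G\<rbrakk> \<Longrightarrow> x \<otimes> inv y \<in> V r \<longleftrightarrow> D x y \<le> r"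
  by (simp add: V_def dist_quotient)

lemma subgroup_V: "0 \<le> r \<Longrightarrow> subgroup (V r) G"
proof (rule subgroupI)
  assume r: "0 \<le> r"
  show "V r \<subseteq> carrier G" by (rule V_subset)
  show "V r \<noteq> {}" using r by (auto simp: V_def intro!: exI[of _ \<one>])
  have inv: "inv a \<in> V r" if "a \<in> V r" for a
    using that dist_quotient[of \<one> a] by (simp add: V_def commute)
  then show "\<And>a. a \<in> V r \<Longrightarrow> inv a \<in> V r" .
  fix a b assume a: "a \<in> V r" and b: "b \<in> V r"
  have ac: "a \<in> carrier G" and bc: "b \<in> carrier G" using a b by (auto simp: V_def)
  have "D (a \<otimes> b) b = D a \<one>" using invariant[of a \<one> b] ac bc by simp
  then show "a \<otimes> b \<in> V r"
    using ultrametric[of "a \<otimes> b" b \<one>] a b ac bc by (simp add: V_def)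
qed

lemma one_in_V: "0 \<le> r \<Longrightarrow> \<one> \<in> V r"
  by (simp add: V_def)

lemma mcball_one: "mcball \<one> r = V r"
  by (auto simp: V_def commute)

lemma closedin_V: "closedin mtopology (V r)"
  using closedin_mcball[of \<one> r] by (simp add: mcball_one)

lemma discrete_iff: "mtopology = discrete_topology (carrier G) \<longleftrightarrow> (\<exists>s>0. V s = {\<one>})"
proof
  assume "mtopology = discrete_topology (carrier G)"
  then have "openin mtopology {\<one>}" by simp
  then obtain r where r: "r > 0" "mball \<one> r \<subseteq> {\<one>}" by (auto simp: openin_mtopology)
  have "V (r/2) \<subseteq> mball \<one> r" using r by (auto simp: V_def commute)
  then have "V (r/2) = {\<one>}" using r one_in_V[of "r/2"] by auto
  then show "\<exists>s>0. V s = {\<one>}" using r by (intro exI[of _ "r/2"]) auto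
next
  assume "\<exists>s>0. V s = {\<one>}"
  then obtain s where s: "s > 0" "V s = {\<one>}" by blast
  have "openin mtopology {x}" if x: "x \<in> carrier G" for x
  proof -
    have "mball x s \<subseteq> {x}"
    proof
      fix y assume y: "y \<in> mball x s"
      then have "x \<otimes> inv y \<in> V s" using x by (simp add: quotient_in_V_iff)
      then show "y \<in> {x}" using s x y
        by (metis in_mball inv_equality inv_inv inv_closed singletonD singletonI)
    qed
    then show ?thesis using s x by (auto simp: openin_mtopology)
  qed
  then show "mtopology = discrete_topology (carrier G)"
    by (metis discrete_topology_unique topspace_mtopology)
qed

lemma indep_quotient_notin:
  assumes "indep W (\<lambda>b. b) B" "b \<in> B" "b' \<in> B" "b \<noteq> b'"
  shows "b \<otimes> inv b' \<notin> W"
proof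
  assume W: "b \<otimes> inv b' \<in> W"
  have p: "p \<ge> 2" using prime_p by (simp add: prime_ge_2_nat)
  define c where "c = (\<lambda>k. if k = b then 1 else int p - 1)"
  have bc: "b \<in> carrier G" "b' \<in> carrier G" using indep_in_carrier[OF assms(1)] assms by auto
  have "b' [^] (int p - 1) = inv b'"
    using bc exponent[OF bc(2)] by (simp add: int_pow_diff int_pow_int)
  then have "(\<Otimes>k\<in>{b,b'}. k [^] c k) = b \<otimes> inv b'"
    using bc assms by (simp add: c_def)
  then have "c b = 0"
    using indepD[OF assms(1), of "{b,b'}" c b] W p assms by (auto simp: c_def)
  then show False by (simp add: c_def)
qed

text \<open>Elements that are independent modulo the ball of radius \<open>s\<close> are pairwise at distance
  greater than \<open>s\<close>, so a finite cover by balls of radius \<open>s\<close> separates them.\<close>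

lemma compact_imp_finite_indep:
  assumes "compactin mtopology (V r)" "B \<subseteq> V r" "indep (V s) (\<lambda>b. b) B" "0 < s"
  shows "finite B"
proof -
  have "mtotally_bounded (V r)" by (rule compactin_imp_mtotally_bounded[OF assms(1)])
  then have "\<exists>K. finite K \<and> K \<subseteq> V r \<and> V r \<subseteq> (\<Union>x\<in>K. mball x s)"
    using assms(4) by (simp add: mtotally_bounded_def)
  then obtain K where K: "finite K" "K \<subseteq> V r" "V r \<subseteq> (\<Union>x\<in>K. mball x s)" by (elim exE conjE)
  have "\<forall>b\<in>B. \<exists>x\<in>K. b \<in> mball x s" using K(3) assms(2) by blast
  then obtain g where g: "\<And>b. b \<in> B \<Longrightarrow> g b \<in> K \<and> b \<in> mball (g b) s" by metis
  have "inj_on g B"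
  proof (rule inj_onI, rule ccontr)
    fix b b' assume b: "b \<in> B" "b' \<in> B" "g b = g b'" "b \<noteq> b'"
    have "D b (g b) < s" "D (g b) b' < s" "b \<in> carrier G" "b' \<in> carrier G" "g b \<in> carrier G"
      using g[OF b(1)] g[OF b(2)] b(3) by (auto simp: commute)
    then have "D b b' \<le> s" using ultrametric[of b "g b" b'] by linarith
    then have "b \<otimes> inv b' \<in> V s" using \<open>b \<in> carrier G\<close> \<open>b' \<in> carrier G\<close> by (simp add: quotient_in_V_iff)
    then show False using indep_quotient_notin[OF assms(3) b(1,2,4)] by blast
  qed
  moreover have "g ` B \<subseteq> K" using g by auto
  ultimately show ?thesis using K(1) finite_imageD finite_subset by metis
qed

lemma finite_carrier_Fsum: "finite B \<Longrightarrow> finite (carrier (sum_group B (\<lambda>_. Fp p)))"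
  by (rule finite_subset[of _ "B \<rightarrow>\<^sub>E {0..<int p}"]) (simp_all add: carrier_Fsum subset_iff finite_PiE)

text \<open>The finitely many combinations of a finite basis modulo a ball form a net. Together with
  \<open>compact_imp_finite_indep\<close> this translates total boundedness into finiteness of bases.\<close>

lemma finite_basis_imp_cover:
  assumes U: "subgroup U G" and B: "finite B" "B \<subseteq> U" "U \<subseteq> span (V s) B"
  shows "\<exists>K. finite K \<and> K \<subseteq> U \<and> (\<forall>x\<in>U. \<exists>y\<in>K. D y x \<le> s)"
proof (intro exI conjI ballI)
  let ?S = "carrier (sum_group B (\<lambda>_. Fp p))"
  let ?K = "lincomb (\<lambda>b. b) B ` ?S"
  have Uc: "U \<subseteq> carrier G" using U by (rule subgroup.subset)
  show "finite ?K" using finite_carrier_Fsum[OF B(1)] by simp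
  show K: "?K \<subseteq> U"
  proof
    fix x assume "x \<in> ?K"
    then obtain c where "x = lincomb (\<lambda>b. b) B c" by blast
    then have "x = (\<Otimes>i\<in>B. i [^] c i)"
      using lincomb_eq_finprod[of "\<lambda>b. b" B B c] B Uc by auto
    also have "\<dots> \<in> U" by (rule finprod_in_subgroup[OF U B(1)]) (use subgroup_int_pow_closed[OF U] B in auto)
    finally show "x \<in> U" .
  qed
  fix x assume x: "x \<in> U"
  then obtain c where c: "c \<in> ?S" "x \<otimes> inv (lincomb (\<lambda>b. b) B c) \<in> V s"
    using B(3) unfolding span_def by blast
  have "lincomb (\<lambda>b. b) B c \<in> carrier G" using K c(1) Uc by blast
  then have "D (lincomb (\<lambda>b. b) B c) x \<le> s"
    using c(2) x Uc by (subst commute) (simp add: quotient_in_V_iff subset_iff)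
  then show "\<exists>y\<in>?K. D y x \<le> s" using c(1) by blast
qed

text \<open>If all bases of the ball modulo smaller balls were finite, the ball would be totally
  bounded, and as a closed subset of a complete space it would be compact.\<close>

lemma noncompact_imp_infinite_indep:
  assumes "\<not> compactin mtopology (V r)" "0 \<le> r"
  shows "\<exists>s B. 0 < s \<and> infinite B \<and> B \<subseteq> V r \<and> indep (V s) (\<lambda>b. b) B"
proof (rule ccontr)
  assume contra: "\<not> ?thesis"
  have "mtotally_bounded (V r)"
    unfolding mtotally_bounded_def
  proof (intro allI impI)
    fix e :: real assume e: "0 < e"
    have "{} \<subseteq> V r" "indep (V (e/2)) (\<lambda>b. b) {}" by (auto simp: indep_def)
    then obtain B where B: "B \<subseteq> V r" "indep (V (e/2)) (\<lambda>b. b) B" "V r \<subseteq> span (V (e/2)) B"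
      using basis_extension[OF subgroup_V subgroup_V[OF assms(2)]] e by (metis half_gt_zero less_eq_real_def)
    have "finite B" using contra B e by (meson half_gt_zero)
    then obtain K where K: "finite K" "K \<subseteq> V r" "\<forall>x\<in>V r. \<exists>y\<in>K. D y x \<le> e/2"
      using finite_basis_imp_cover[OF subgroup_V[OF assms(2)] _ B(1,3)] by blast
    have "V r \<subseteq> (\<Union>x\<in>K. mball x e)"
    proof
      fix x assume x: "x \<in> V r"
      then obtain y where y: "y \<in> K" "D y x \<le> e/2" using K by blast
      then have "x \<in> mball y e" using x K e V_subset by auto
      then show "x \<in> (\<Union>x\<in>K. mball x e)" using y by blast
    qed
    then show "\<exists>K. finite K \<and> K \<subseteq> V r \<and> V r \<subseteq> (\<Union>x\<in>K. mball x e)" using K by blast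
  qed
  then have "compactin mtopology (mtopology closure_of (V r))"
    using mtotally_bounded_eq_compact_closure_of[OF complete] by blast
  then show False using assms(1) closedin_V closure_of_eq by metis
qed

lemma proper_iff: "proper_space (carrier G) D \<longleftrightarrow> (\<forall>r. compactin mtopology (V r))"
proof
  assume "proper_space (carrier G) D"
  moreover have "mbounded (V r)" for r
    unfolding mbounded_def using mcball_one[of r] by blast
  ultimately show "\<forall>r. compactin mtopology (V r)"
    unfolding proper_space_def using closedin_V by blast
next
  assume C: "\<forall>r. compactin mtopology (V r)"
  show "proper_space (carrier G) D"
    unfolding proper_space_def
  proof (intro allI impI)
    fix S assume S: "closedin mtopology S \<and> mbounded S"
    then have "mbounded (insert \<one> S)" by (simp add: mbounded_insert)
    then obtain r where "\<forall>x\<in>S. D x \<one> \<le> r" unfolding mbounded_alt by blast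
    then have "S \<subseteq> V r" using S closedin_subset by (fastforce simp: V_def)
    then show "compactin mtopology S"
      using C S closed_compactin by blast
  qed
qed

lemma bounded_iff: "mbounded (carrier G) \<longleftrightarrow> (\<exists>r\<ge>0. V r = carrier G)"
proof
  assume "mbounded (carrier G)"
  then obtain B where "\<forall>x\<in>carrier G. \<forall>y\<in>carrier G. D x y \<le> B"
    unfolding mbounded_alt by blast
  then have "D x \<one> \<le> max B 0" if "x \<in> carrier G" for x
    using that by (meson max.coboundedI1 one_closed)
  then have "V (max B 0) = carrier G" by (auto simp: V_def)
  then show "\<exists>r\<ge>0. V r = carrier G" by (intro exI[of _ "max B 0"]) auto
next
  assume "\<exists>r\<ge>0. V r = carrier G"
  then show "mbounded (carrier G)" unfolding mbounded_def using mcball_one by blast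
qed

lemma compact_iff: "compact_space mtopology \<longleftrightarrow> mbounded (carrier G) \<and> proper_space (carrier G) D"
proof
  assume C: "compact_space mtopology"
  then have "compactin mtopology (carrier G)" by (simp add: compact_space_def)
  then have "mbounded (carrier G)" by (rule compactin_imp_mbounded)
  moreover have "proper_space (carrier G) D"
    unfolding proper_space_def using C closedin_compact_space by blast
  ultimately show "mbounded (carrier G) \<and> proper_space (carrier G) D" by blast
next
  assume "mbounded (carrier G) \<and> proper_space (carrier G) D"
  then show "compact_space mtopology"
    unfolding proper_space_def compact_space_def by (metis closedin_topspace topspace_mtopology)
qed

text \<open>By homogeneity it suffices to look at the neutral element: translations are isometries
  and carry a compact ball around it to a compact ball around any other point.\<close>

lemma locally_compact_iff: "locally_compact_space mtopology \<longleftrightarrow> (\<exists>s>0. compactin mtopology (V s))"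
proof
  assume "locally_compact_space mtopology"
  then obtain U K where UK: "openin mtopology U" "compactin mtopology K" "\<one> \<in> U" "U \<subseteq> K"
    unfolding locally_compact_space_def by (metis one_closed topspace_mtopology)
  then obtain r where r: "r > 0" "mball \<one> r \<subseteq> U" by (auto simp: openin_mtopology)
  have "V (r/2) \<subseteq> mball \<one> r" using r by (auto simp: V_def commute)
  then have "V (r/2) \<subseteq> K" using r UK by blast
  then have "compactin mtopology (V (r/2))" using closed_compactin UK closedin_V by blast
  then show "\<exists>s>0. compactin mtopology (V s)" using r by (intro exI[of _ "r/2"]) auto
next
  assume "\<exists>s>0. compactin mtopology (V s)"
  then obtain s where s: "s > 0" "compactin mtopology (V s)" by blast
  have "compactin mtopology (mcball x s)" if x: "x \<in> carrier G" for x
  proof -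
    have "continuous_map mtopology mtopology (\<lambda>y. y \<otimes> x)"
      unfolding continuous_map_to_metric
    proof (intro ballI allI impI)
      fix y and e :: real assume y: "y \<in> topspace mtopology" and e: "0 < e"
      show "\<exists>U. openin mtopology U \<and> y \<in> U \<and> (\<forall>z\<in>U. z \<otimes> x \<in> mball (y \<otimes> x) e)"
        by (rule exI[of _ "mball y e"]) (use y e x invariant in auto)
    qed
    then have "compactin mtopology ((\<lambda>y. y \<otimes> x) ` V s)" using image_compactin s by blast
    moreover have "(\<lambda>y. y \<otimes> x) ` V s = mcball x s"
    proof (intro equalityI subsetI)
      fix y assume "y \<in> (\<lambda>y. y \<otimes> x) ` V s"
      then obtain z where z: "z \<in> V s" "y = z \<otimes> x" by blast
      have zc: "z \<in> carrier G" using z V_subset by blast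
      have "D (z \<otimes> x) x = D z \<one>" using invariant[of z \<one> x] x zc by simp
      then show "y \<in> mcball x s" using z zc x by (auto simp: V_def commute)
    next
      fix y assume y: "y \<in> mcball x s"
      have "y \<otimes> inv x \<in> V s" using y x by (simp add: quotient_in_V_iff commute)
      moreover have "y = (y \<otimes> inv x) \<otimes> x" using x y by (simp add: m_assoc)
      ultimately show "y \<in> (\<lambda>y. y \<otimes> x) ` V s" by blast
    qed
    ultimately show ?thesis by simp
  qed
  then show "locally_compact_space mtopology"
    unfolding locally_compact_space_def
    by (metis centre_in_mball_iff mball_subset_mcball openin_mball s(1) topspace_mtopology)
qed

text \<open>The central structural result. Suppose that \<open>\<phi> i\<close> is a homomorphism on the whole group
  which induces an isomorphism from \<open>W i / W (Suc i)\<close> to \<open>K i\<close>, where \<open>W 0\<close> is the whole group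
  and the other \<open>W i\<close> are balls shrinking to the neutral element. Then an element lies in
  \<open>W i\<close> exactly when its first \<open>i\<close> coordinates vanish. Hence the joint map is
  injective, and prescribing the first \<open>i\<close> coordinates confines an element to a coset of
  \<open>W i\<close>, so that the map is a homeomorphism onto its image. It is
  onto because the coordinates can be prescribed one after the other (a correction in \<open>W i\<close> does
  not change the earlier ones) and the partial solutions converge by completeness.\<close>

theorem product_decomposition:
  fixes K :: "nat \<Rightarrow> 'k monoid" and W :: "nat \<Rightarrow> 'a set" and s :: "nat \<Rightarrow> real"
  assumes K: "\<And>i. group (K i)"
    and s: "\<And>i. 0 < s i" "\<And>i. s (Suc i) \<le> s i" "s \<longlonglongrightarrow> 0"
    and W: "W 0 = carrier G" "\<And>i. W (Suc i) = V (s i)"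
    and hom: "\<And>i. \<phi> i \<in> hom G (K i)"
    and onto: "\<And>i. \<phi> i ` W i = carrier (K i)"
    and trivial: "\<And>i x. x \<in> W (Suc i) \<Longrightarrow> \<phi> i x = \<one>\<^bsub>K i\<^esub>"
    and kernel: "\<And>i x. \<lbrakk>x \<in> W i; \<phi> i x = \<one>\<^bsub>K i\<^esub>\<rbrakk> \<Longrightarrow> x \<in> W (Suc i)"
  shows "(G, mtopology) \<simeq>\<^sub>t
    (product_group UNIV K, product_topology (\<lambda>i. discrete_topology (carrier (K i))) UNIV)"
proof -
  have gh: "group_hom G (K i) (\<phi> i)" for i
    using K hom by (simp add: group_hom_def group_hom_axioms_def is_group)
  have sW: "subgroup (W i) G" for i
    using W subgroup_self subgroup_V s(1) by (cases i) (auto simp: less_imp_le)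
  have Wc: "W i \<subseteq> carrier G" for i using sW subgroup.subset by blast
  have Wdec: "W (Suc i) \<subseteq> W i" for i
    using W s V_mono V_subset by (cases i) auto
  have Wiff: "x \<in> W i \<longleftrightarrow> (\<forall>j<i. \<phi> j x = \<one>\<^bsub>K j\<^esub>)" if "x \<in> carrier G" for x i
  proof (induction i)
    case 0 then show ?case using that W by simp
  next
    case (Suc i)
    then show ?case using kernel[of x i] trivial[of x i] Wdec[of i] by (auto simp: less_Suc_eq)
  qed
  have phi_quot: "\<phi> i (x \<otimes> inv y) = \<one>\<^bsub>K i\<^esub> \<longleftrightarrow> \<phi> i x = \<phi> i y" if "x \<in> carrier G" "y \<in> carrier G" for x y i
  proof -
    interpret h: group_hom G "K i" "\<phi> i" by (rule gh)
    show ?thesis using that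
      by simp (metis h.H.inv_equality h.H.inv_inv h.H.r_inv h.hom_closed h.H.inv_closed)
  qed
  have close: "D x y \<le> s i \<longleftrightarrow> (\<forall>j\<le>i. \<phi> j x = \<phi> j y)" if "x \<in> carrier G" "y \<in> carrier G" for x y i
    using quotient_in_V_iff[OF that, of "s i"] Wiff[of "x \<otimes> inv y" "Suc i"] that
    by (simp add: W(2) phi_quot[OF that] less_Suc_eq_le)
  define \<Phi> where "\<Phi> x = (\<lambda>i. \<phi> i x)" for x
  let ?P = "product_group UNIV K"
  let ?T = "product_topology (\<lambda>i. discrete_topology (carrier (K i))) UNIV"
  have inj: "inj_on \<Phi> (carrier G)"
  proof (rule inj_onI)
    fix x y assume x: "x \<in> carrier G" and y: "y \<in> carrier G" and eq: "\<Phi> x = \<Phi> y"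
    have "D x y \<le> s i" for i using close[OF x y] eq by (auto simp: \<Phi>_def fun_eq_iff)
    then have "D x y \<le> 0" using LIMSEQ_le_const[OF s(3)] by blast
    then show "x = y" using x y by (metis nonneg order_antisym zero)
  qed
  have homP: "\<Phi> \<in> hom G ?P"
    using hom by (auto simp: hom_def \<Phi>_def Pi_iff fun_eq_iff)
  have surj: "\<Phi> ` carrier G = carrier ?P"
  proof
    show "\<Phi> ` carrier G \<subseteq> carrier ?P" using homP by (auto simp: hom_def)
    show "carrier ?P \<subseteq> \<Phi> ` carrier G"
    proof
      fix c assume "c \<in> carrier ?P"
      then have c: "c i \<in> carrier (K i)" for i by auto
      have "\<exists>P. \<forall>n. (P n \<in> carrier G \<and> (\<forall>j<n. \<phi> j (P n) = c j)) \<and> True"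
      proof (rule dependent_nat_choice)
        show "\<exists>x. x \<in> carrier G \<and> (\<forall>j<0. \<phi> j x = c j)" using one_closed by blast
        fix x n assume x: "x \<in> carrier G \<and> (\<forall>j<n. \<phi> j x = c j)"
        interpret h: group_hom G "K n" "\<phi> n" by (rule gh)
        \<comment> \<open>The error in coordinate \<open>n\<close> is corrected by an element of \<open>W n\<close>, invisible to the earlier coordinates.\<close>
        have "inv\<^bsub>K n\<^esub> (\<phi> n x) \<otimes>\<^bsub>K n\<^esub> c n \<in> \<phi> n ` W n" using onto x c by simp
        then obtain z where z: "z \<in> W n" "\<phi> n z = inv\<^bsub>K n\<^esub> (\<phi> n x) \<otimes>\<^bsub>K n\<^esub> c n" by force
        have zc: "z \<in> carrier G" using z Wc by blast
        have "\<phi> j (x \<otimes> z) = c j" if "j < Suc n" for j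
        proof (cases "j = n")
          case True
          then show ?thesis using z zc x c[of n]
            by simp (metis h.H.inv_closed h.H.l_one h.H.m_assoc h.H.r_inv h.hom_closed)
        next
          case False
          interpret j: group_hom G "K j" "\<phi> j" by (rule gh)
          have "\<phi> j z = \<one>\<^bsub>K j\<^esub>" using Wiff[OF zc, of n] z that False by auto
          then show ?thesis using that False x zc c[of j] by auto
        qed
        then show "\<exists>y. (y \<in> carrier G \<and> (\<forall>j<Suc n. \<phi> j y = c j)) \<and> True"
          using x zc by blast
      qed
      then obtain P where P: "\<And>n. P n \<in> carrier G" "\<And>n j. j < n \<Longrightarrow> \<phi> j (P n) = c j" by blast
      have "MCauchy P"
        unfolding MCauchy_def
      proof (intro conjI allI impI)
        show "range P \<subseteq> carrier G" using P by blast
        fix e :: real assume "0 < e"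
        then obtain N where N: "s N < e"
          using order_tendstoD(2)[OF s(3)] by (meson eventually_sequentially order_refl)
        have "D (P m) (P n) < e" if "m \<ge> Suc N" "n \<ge> Suc N" for m n
          using close[OF P(1) P(1), of m n N] P(2) that N by fastforce
        then show "\<exists>N. \<forall>n n'. N \<le> n \<longrightarrow> N \<le> n' \<longrightarrow> D (P n) (P n') < e" by blast
      qed
      then obtain x where lim: "limitin mtopology P x sequentially"
        using complete unfolding mcomplete_def by blast
      have x: "x \<in> carrier G" using lim limitin_mspace by blast
      have "\<phi> j x = c j" for j
      proof -
        have "\<forall>\<^sub>F n in sequentially. P n \<in> carrier G \<and> D (P n) x < s j"
          using lim s(1)[of j] unfolding limit_metric_sequentially limitin_metric by blast
        then obtain n where n: "D (P n) x < s j" "n > j"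
          by (metis (mono_tags, lifting) eventually_conj eventually_gt_at_top eventually_happens' sequentially_bot)
        then show ?thesis using close[OF P(1) x, of n j] P(2)[OF n(2)] by auto
      qed
      then have "c = \<Phi> x" by (auto simp: \<Phi>_def)
      then show "c \<in> \<Phi> ` carrier G" using x by blast
    qed
  qed
  have cont: "continuous_map mtopology ?T \<Phi>"
    unfolding continuous_map_componentwise_UNIV
  proof
    fix i
    show "continuous_map mtopology (discrete_topology (carrier (K i))) (\<lambda>x. \<Phi> x i)"
      unfolding continuous_map_def
    proof (intro conjI allI impI)
      show "(\<lambda>x. \<Phi> x i) \<in> topspace mtopology \<rightarrow> topspace (discrete_topology (carrier (K i)))"
        using hom[of i] by (auto simp: hom_def \<Phi>_def)
      fix U
      have "mball x (s i) \<subseteq> {x \<in> carrier G. \<phi> i x \<in> U}" if "x \<in> carrier G" "\<phi> i x \<in> U" for x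
        using close[OF that(1), of _ i] that by fastforce
      then show "openin mtopology {x \<in> topspace mtopology. \<Phi> x i \<in> U}"
        using s(1)[of i] by (auto simp: openin_mtopology \<Phi>_def)
    qed
  qed
  have open': "open_map mtopology ?T \<Phi>"
    unfolding open_map_def openin_product_topology_alt
  proof (intro allI impI ballI)
    fix U c assume U: "openin mtopology U" and "c \<in> \<Phi> ` U"
    then obtain x where x: "x \<in> U" "c = \<Phi> x" by blast
    have xc: "x \<in> carrier G" using U x openin_subset by fastforce
    obtain r where r: "r > 0" "mball x r \<subseteq> U" using U x unfolding openin_mtopology by blast
    obtain N where N: "s N < r"
      using order_tendstoD(2)[OF s(3) r(1)] by (meson eventually_sequentially order_refl)
    define B where "B i = (if i \<le> N then {\<phi> i x} else carrier (K i))" for i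
    have \<phi>c: "\<phi> i x \<in> carrier (K i)" for i using hom[of i] xc by (auto simp: hom_def)
    have "Pi\<^sub>E UNIV B \<subseteq> \<Phi> ` U"
    proof
      fix d assume d: "d \<in> Pi\<^sub>E UNIV B"
      then have "d \<in> carrier ?P" using \<phi>c by (force simp: B_def PiE_iff split: if_splits)
      then obtain y where y: "y \<in> carrier G" "d = \<Phi> y" using surj by blast
      have "\<phi> j x = \<phi> j y" if "j \<le> N" for j
        using PiE_mem[OF d, of j] that y(2) by (simp add: B_def \<Phi>_def)
      then have "D x y < r" using close[OF xc y(1), of N] N by simp
      then show "d \<in> \<Phi> ` U" using r y xc by auto
    qed
    moreover have "finite {i \<in> UNIV. B i \<noteq> topspace (discrete_topology (carrier (K i)))}"
      by (rule finite_subset[of _ "{..N}"]) (auto simp: B_def)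
    moreover have "\<forall>i\<in>UNIV. openin (discrete_topology (carrier (K i))) (B i)"
      using \<phi>c by (auto simp: B_def)
    moreover have "c \<in> Pi\<^sub>E UNIV B" using x \<phi>c by (auto simp: B_def \<Phi>_def)
    ultimately show "\<exists>B. finite {i \<in> UNIV. B i \<noteq> topspace (discrete_topology (carrier (K i)))} \<and>
        (\<forall>i\<in>UNIV. openin (discrete_topology (carrier (K i))) (B i)) \<and> c \<in> Pi\<^sub>E UNIV B \<and> Pi\<^sub>E UNIV B \<subseteq> \<Phi> ` U"
      by blast
  qed
  have "homeomorphic_map mtopology ?T \<Phi>"
    by (rule bijective_open_imp_homeomorphic_map[OF cont open']) (use surj inj in auto)
  moreover have "\<Phi> \<in> iso G ?P" using homP inj surj by (auto simp: iso_def bij_betw_def)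
  ultimately show ?thesis unfolding topgroup_iso_def by auto
qed

end

section \<open>Isomorphisms of topological groups\<close>

lemma topgroup_isoI:
  assumes "homeomorphic_maps X Y f g" "f \<in> hom G H" "topspace X = carrier G" "topspace Y = carrier H"
  shows "(G, X) \<simeq>\<^sub>t (H, Y)"
proof -
  have h: "homeomorphic_map X Y f" using assms(1) homeomorphic_map_maps by blast
  then have "bij_betw f (carrier G) (carrier H)"
    using assms(3,4) by (metis bij_betw_def homeomorphic_imp_injective_map homeomorphic_imp_surjective_map)
  then show ?thesis using h assms(2) unfolding topgroup_iso_def iso_def by auto
qed

lemma topgroup_iso_trans: "\<lbrakk>A \<simeq>\<^sub>t B; B \<simeq>\<^sub>t C\<rbrakk> \<Longrightarrow> A \<simeq>\<^sub>t C"
  unfolding topgroup_iso_def by (meson homeomorphic_map_compose iso_set_trans)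

lemma iso_imp_discrete_iso:
  assumes "f \<in> iso G H"
  shows "discrete_group G \<simeq>\<^sub>t discrete_group H"
proof -
  have f: "inj_on f (carrier G)" "f ` carrier G = carrier H"
    using assms by (auto simp: iso_def bij_betw_def)
  have "homeomorphic_map (discrete_topology (carrier G)) (discrete_topology (carrier H)) f"
    by (rule bijective_open_imp_homeomorphic_map) (use f in \<open>auto simp: open_map_def\<close>)
  then show ?thesis using assms unfolding topgroup_iso_def discrete_group_def by auto
qed

lemma topspace_Fprod: "topspace (snd (Fprod p I)) = carrier (fst (Fprod p I))"
  by (simp add: Fprod_def power_group_def discrete_group_def)

text \<open>Serves both finite cones and the finite layers of compact ones, where the product
  topology on a layer has to be recognised as the discrete one.\<close>

lemma product_topology_discrete_finite:
  assumes "finite I"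
  shows "product_topology (\<lambda>i. discrete_topology (S i)) I = discrete_topology (Pi\<^sub>E I S)"
proof -
  have "openin (product_topology (\<lambda>i. discrete_topology (S i)) I) {x}" if x: "x \<in> Pi\<^sub>E I S" for x
  proof -
    have "{x} = (\<Pi>\<^sub>E i\<in>I. {x i})" using x by (auto simp: PiE_singleton PiE_iff)
    then show ?thesis using x assms by (simp add: openin_PiE PiE_iff)
  qed
  then have "discrete_topology (Pi\<^sub>E I S) = product_topology (\<lambda>i. discrete_topology (S i)) I"
    unfolding discrete_topology_unique by simp
  then show ?thesis by (rule sym)
qed

lemma finite_Fdsum_iso_Fprod:
  assumes "finite I" "0 < p"
  shows "Fdsum p I \<simeq>\<^sub>t Fprod p I"
proof -
  have c: "carrier (sum_group I (\<lambda>_. Fp p)) = I \<rightarrow>\<^sub>E carrier (Fp p)"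
    using assms by (simp add: carrier_sum_group)
  have "id \<in> iso (sum_group I (\<lambda>_. Fp p)) (product_group I (\<lambda>_. Fp p))"
    by (simp add: iso_def hom_def c Pi_iff)
  moreover have "homeomorphic_map (discrete_topology (I \<rightarrow>\<^sub>E carrier (Fp p))) (discrete_topology (I \<rightarrow>\<^sub>E carrier (Fp p))) id"
    by (simp add: homeomorphic_map_id)
  ultimately show ?thesis
    unfolding topgroup_iso_def Fdsum_def Fprod_def power_group_def discrete_group_def
    using assms(1) by (auto simp: c product_topology_discrete_finite)
qed

lemma iso_sum_group_reindex:
  assumes h: "bij_betw h I J" and K: "group K"
  shows "(\<lambda>u. \<lambda>i\<in>I. u (h i)) \<in> iso (sum_group J (\<lambda>_. K)) (sum_group I (\<lambda>_. K))"
proof -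
  let ?f = "\<lambda>u. \<lambda>i\<in>I. u (h i)"
  let ?g = "\<lambda>v. \<lambda>j\<in>J. v (inv_into I h j)"
  have hI: "h i \<in> J" if "i \<in> I" for i using h that by (auto simp: bij_betw_def)
  have gJ: "inv_into I h j \<in> I" "h (inv_into I h j) = j" if "j \<in> J" for j
    using h that by (auto simp: bij_betw_def inv_into_into f_inv_into_f)
  have gh: "inv_into I h (h i) = i" if "i \<in> I" for i using h that by (auto simp: bij_betw_def)
  have f: "?f u \<in> carrier (sum_group I (\<lambda>_. K))" if "u \<in> carrier (sum_group J (\<lambda>_. K))" for u
  proof -
    have u: "u \<in> J \<rightarrow>\<^sub>E carrier K" "finite {j \<in> J. u j \<noteq> \<one>\<^bsub>K\<^esub>}" using that K by (auto simp: carrier_sum_group)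
    have "{i \<in> I. u (h i) \<noteq> \<one>\<^bsub>K\<^esub>} \<subseteq> inv_into I h ` {j \<in> J. u j \<noteq> \<one>\<^bsub>K\<^esub>}"
      using hI gh by force
    then have "finite {i \<in> I. u (h i) \<noteq> \<one>\<^bsub>K\<^esub>}" using u(2) finite_surj by blast
    then show ?thesis using u(1) K hI by (auto simp: carrier_sum_group PiE_iff cong: conj_cong)
  qed
  have g: "?g v \<in> carrier (sum_group J (\<lambda>_. K))" if "v \<in> carrier (sum_group I (\<lambda>_. K))" for v
  proof -
    have v: "v \<in> I \<rightarrow>\<^sub>E carrier K" "finite {i \<in> I. v i \<noteq> \<one>\<^bsub>K\<^esub>}" using that K by (auto simp: carrier_sum_group)
    have "{j \<in> J. v (inv_into I h j) \<noteq> \<one>\<^bsub>K\<^esub>} \<subseteq> h ` {i \<in> I. v i \<noteq> \<one>\<^bsub>K\<^esub>}"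
      using gJ by force
    then have "finite {j \<in> J. v (inv_into I h j) \<noteq> \<one>\<^bsub>K\<^esub>}" using v(2) finite_surj by blast
    then show ?thesis using v(1) K gJ by (auto simp: carrier_sum_group PiE_iff cong: conj_cong)
  qed
  have "bij_betw ?f (carrier (sum_group J (\<lambda>_. K))) (carrier (sum_group I (\<lambda>_. K)))"
  proof (rule bij_betw_byWitness[where f' = ?g])
    show "\<forall>u\<in>carrier (sum_group J (\<lambda>_. K)). ?g (?f u) = u"
    proof
      fix u assume "u \<in> carrier (sum_group J (\<lambda>_. K))"
      then have "u \<in> extensional J" using K by (auto simp: carrier_sum_group PiE_iff)
      then show "?g (?f u) = u" using gJ by (auto simp: fun_eq_iff extensional_def)
    qed
    show "\<forall>v\<in>carrier (sum_group I (\<lambda>_. K)). ?f (?g v) = v"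
    proof
      fix v assume "v \<in> carrier (sum_group I (\<lambda>_. K))"
      then have "v \<in> extensional I" using K by (auto simp: carrier_sum_group PiE_iff)
      then show "?f (?g v) = v" using gh hI by (auto simp: fun_eq_iff extensional_def)
    qed
  qed (use f g in auto)
  moreover have "?f \<in> hom (sum_group J (\<lambda>_. K)) (sum_group I (\<lambda>_. K))"
    by (rule homI) (use f hI in \<open>auto simp: fun_eq_iff\<close>)
  ultimately show ?thesis by (simp add: iso_def)
qed

text \<open>Lets the compact case be treated together with the other locally compact ones, with
  trivial discrete factor.\<close>

lemma Fprod_times_trivial: "Fprod p I \<times>\<^sub>t Fdsum p {} \<simeq>\<^sub>t Fprod p I"
proof -
  define H where "H = fst (Fprod p I)"
  define X where "X = snd (Fprod p I)"
  define S where "S = sum_group ({} :: 'b set) (\<lambda>_. Fp p)"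
  have S: "carrier S = {\<lambda>_. undefined}" by (auto simp: S_def carrier_sum_group)
  have X: "topspace X = carrier H" unfolding X_def H_def by (rule topspace_Fprod)
  have "(H \<times>\<times> S, prod_topology X (discrete_topology (carrier S))) \<simeq>\<^sub>t (H, X)"
  proof (rule topgroup_isoI[where f = fst and g = "\<lambda>x. (x, \<lambda>_. undefined)"])
    show "homeomorphic_maps (prod_topology X (discrete_topology (carrier S))) X fst (\<lambda>x. (x, \<lambda>_. undefined))"
      unfolding homeomorphic_maps_def
      by (auto simp: S continuous_map_fst intro!: continuous_map_pairedI)
  qed (auto simp: hom_def X S)
  then show ?thesis by (simp add: times_group_def H_def X_def S_def Fdsum_def discrete_group_def)
qed

text \<open>Separates the compact and the discrete factor of a product with finite layers after the
  first one. The coordinates of the finite layers are collected in a single product, indexed by all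
  pairs of a layer and a basis element of it, so that their number is all that matters.\<close>

lemma regroup_product:
  fixes B :: "nat \<Rightarrow> 'b set" and k :: "'j \<Rightarrow> 'b"
  assumes p: "0 < p" and fin: "\<And>i. 0 < i \<Longrightarrow> finite (B i)"
    and h: "bij_betw h (UNIV :: nat set) (Sigma {0<..} B)" and k: "bij_betw k I (B 0)"
  shows "(product_group UNIV (\<lambda>i. sum_group (B i) (\<lambda>_. Fp p)),
      product_topology (\<lambda>i. discrete_topology (carrier (sum_group (B i) (\<lambda>_. Fp p)))) UNIV)
    \<simeq>\<^sub>t Fprod p (UNIV :: nat set) \<times>\<^sub>t Fdsum p I"
proof -
  let ?S = "\<lambda>i. sum_group (B i) (\<lambda>_. Fp p)"
  let ?R = "sum_group I (\<lambda>_. Fp p)"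
  let ?G = "product_group UNIV ?S"
  let ?X = "product_topology (\<lambda>i. discrete_topology (carrier (?S i))) UNIV"
  let ?H = "product_group (UNIV :: nat set) (\<lambda>_. Fp p) \<times>\<times> ?R"
  let ?Y = "product_topology (\<lambda>_. discrete_topology (carrier (Fp p))) (UNIV :: nat set)"
  let ?Z = "discrete_topology (carrier ?R)"
  define e where "e = (\<lambda>u. \<lambda>i\<in>I. u (k i) :: int)"
  have e: "e \<in> iso (?S 0) ?R" unfolding e_def by (rule iso_sum_group_reindex[OF k]) simp
  then have ebij: "bij_betw e (carrier (?S 0)) (carrier ?R)" by (simp add: iso_def)
  define e' where "e' = inv_into (carrier (?S 0)) e"
  have e': "e' v \<in> carrier (?S 0)" "e (e' v) = v" if "v \<in> carrier ?R" for v
    using ebij that unfolding e'_def by (auto simp: bij_betw_def inv_into_into f_inv_into_f)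
  have e'e: "e' (e u) = u" if "u \<in> carrier (?S 0)" for u
    using ebij that unfolding e'_def by (auto simp: bij_betw_def)
  have eR: "e u \<in> carrier ?R" if "u \<in> carrier (?S 0)" for u
    using ebij that by (auto simp: bij_betw_def)
  define h' where "h' = inv_into UNIV h"
  have h': "h (h' x) = x" if "x \<in> Sigma {0<..} B" for x
    using h that unfolding h'_def by (metis bij_betw_def f_inv_into_f)
  have h'h: "h' (h n) = n" for n
    using h unfolding h'_def by (simp add: bij_betw_def)
  have hn: "0 < fst (h n)" "snd (h n) \<in> B (fst (h n))" for n
  proof -
    have "h n \<in> Sigma {0<..} B" using h by (auto simp: bij_betw_def)
    then show "0 < fst (h n)" "snd (h n) \<in> B (fst (h n))" by (auto simp: mem_Sigma_iff split: prod.splits)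
  qed
  have Si: "carrier (?S i) = B i \<rightarrow>\<^sub>E carrier (Fp p)" if "0 < i" for i
    using fin[OF that] by (simp add: carrier_sum_group)
  define f where "f c = (\<lambda>n. c (fst (h n)) (snd (h n)), e (c 0))" for c :: "nat \<Rightarrow> 'b \<Rightarrow> int"
  define g where "g w = (\<lambda>i. if i = 0 then e' (snd w) else (\<lambda>b\<in>B i. fst w (h' (i, b))))"
    for w :: "(nat \<Rightarrow> int) \<times> ('j \<Rightarrow> int)"
  have coord: "c (fst (h n)) (snd (h n)) \<in> carrier (Fp p)" if "c \<in> carrier ?G" for c n
  proof -
    have "c (fst (h n)) \<in> carrier (?S (fst (h n)))" using that by auto
    then show ?thesis using Si[OF hn(1)] hn(2) by auto
  qed
  have contf: "continuous_map ?X (prod_topology ?Y ?Z) f"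
  proof -
    have proj: "continuous_map ?X (discrete_topology (carrier (?S i))) (\<lambda>c. c i)" for i
      by (rule continuous_map_product_projection) simp
    have "continuous_map ?X (discrete_topology (carrier (Fp p))) (\<lambda>c. c (fst (h n)) (snd (h n)))" for n
    proof -
      have "continuous_map (discrete_topology (carrier (?S (fst (h n))))) (discrete_topology (carrier (Fp p))) (\<lambda>u. u (snd (h n)))"
        using Si[OF hn(1)] hn(2) by auto
      from continuous_map_compose[OF proj this] show ?thesis by (simp add: o_def)
    qed
    moreover have "continuous_map ?X ?Z (\<lambda>c. e (c 0))"
    proof -
      have "continuous_map (discrete_topology (carrier (?S 0))) ?Z e" using eR by auto
      from continuous_map_compose[OF proj this] show ?thesis by (simp add: o_def)
    qed
    ultimately show ?thesis
      unfolding f_def by (intro continuous_map_pairedI) (simp_all add: continuous_map_componentwise_UNIV)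
  qed
  have contg: "continuous_map (prod_topology ?Y ?Z) ?X g"
    unfolding continuous_map_componentwise_UNIV
  proof
    fix i
    show "continuous_map (prod_topology ?Y ?Z) (discrete_topology (carrier (?S i))) (\<lambda>w. g w i)"
    proof (cases "i = 0")
      case True
      have "continuous_map ?Z (discrete_topology (carrier (?S 0))) e'" using e' by auto
      from continuous_map_compose[OF continuous_map_snd this] show ?thesis using True by (simp add: g_def o_def)
    next
      case False
      have "continuous_map (prod_topology ?Y ?Z) (product_topology (\<lambda>_. discrete_topology (carrier (Fp p))) (B i)) (\<lambda>w. \<lambda>b\<in>B i. fst w (h' (i, b)))"
        unfolding continuous_map_componentwise
      proof (intro conjI ballI)
        fix b assume b: "b \<in> B i"
        have "continuous_map (prod_topology ?Y ?Z) (discrete_topology (carrier (Fp p))) ((\<lambda>u. u (h' (i, b))) \<circ> fst)"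
          by (rule continuous_map_compose[OF continuous_map_fst continuous_map_product_projection]) simp
        then show "continuous_map (prod_topology ?Y ?Z) (discrete_topology (carrier (Fp p))) (\<lambda>x. (\<lambda>b\<in>B i. fst x (h' (i, b))) b)"
          using b by (simp add: o_def)
      qed auto
      then show ?thesis
        using False Si fin by (simp add: product_topology_discrete_finite g_def)
    qed
  qed
  have gf: "g (f c) = c" if c: "c \<in> carrier ?G" for c
  proof
    fix i
    have ci: "c i \<in> carrier (?S i)" using c by auto
    show "g (f c) i = c i"
    proof (cases "i = 0")
      case True then show ?thesis using ci e'e by (simp add: g_def f_def)
    next
      case False
      have "(\<lambda>b\<in>B i. fst (f c) (h' (i, b))) = c i"
      proof
        fix b
        show "(\<lambda>b\<in>B i. fst (f c) (h' (i, b))) b = c i b"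
          using False ci Si[of i] h'[of "(i, b)"] by (cases "b \<in> B i") (auto simp: f_def PiE_iff extensional_def)
      qed
      then show ?thesis using False by (simp add: g_def)
    qed
  qed
  have fg: "f (g w) = w" if w: "snd w \<in> carrier ?R" for w
  proof -
    have "h' (fst (h n), snd (h n)) = n" for n using h'h by simp
    moreover have "fst (h n) \<noteq> 0" for n using hn(1)[of n] by simp
    ultimately have "fst (f (g w)) n = fst w n" for n using hn(2) by (simp add: f_def g_def del: neq0_conv)
    then have "fst (f (g w)) = fst w" by blast
    moreover have "snd (f (g w)) = snd w" using e'(2)[OF w] by (simp add: f_def g_def)
    ultimately show ?thesis by (simp add: prod_eq_iff)
  qed
  have "(?G, ?X) \<simeq>\<^sub>t (?H, prod_topology ?Y ?Z)"
  proof (rule topgroup_isoI[where f = f and g = g])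
    show "homeomorphic_maps ?X (prod_topology ?Y ?Z) f g"
      unfolding homeomorphic_maps_def using contf contg gf fg by auto
    show "f \<in> hom ?G ?H"
    proof (rule homI)
      fix c d assume c: "c \<in> carrier ?G" and d: "d \<in> carrier ?G"
      have c0: "c 0 \<in> carrier (?S 0)" "d 0 \<in> carrier (?S 0)" using c d by auto
      show "f c \<in> carrier ?H" using coord[OF c] eR[OF c0(1)] by (auto simp: f_def)
      have "e (c 0 \<otimes>\<^bsub>?S 0\<^esub> d 0) = e (c 0) \<otimes>\<^bsub>?R\<^esub> e (d 0)"
        using e c0 by (simp add: iso_def hom_def)
      then show "f (c \<otimes>\<^bsub>?G\<^esub> d) = f c \<otimes>\<^bsub>?H\<^esub> f d"
        using hn by (simp add: f_def restrict_UNIV)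
    qed
  qed auto
  then show ?thesis
    by (simp add: times_group_def Fprod_def power_group_def Fdsum_def discrete_group_def)
qed

text \<open>Dependent choice of radii. Halving at each step makes them tend to zero, while the
  relation \<open>P\<close> between consecutive radii carries the property wanted of the filtration.\<close>

lemma halving_sequence:
  assumes step: "\<And>s::real. 0 < s \<Longrightarrow> \<exists>t. 0 < t \<and> t \<le> s / 2 \<and> P s t" and "0 < s0"
  obtains s :: "nat \<Rightarrow> real" where "s 0 = s0" "\<And>i. 0 < s i" "\<And>i. s (Suc i) \<le> s i"
    "\<And>i. P (s i) (s (Suc i))" "s \<longlonglongrightarrow> 0"
proof -
  obtain nxt where nxt: "\<And>s. 0 < s \<Longrightarrow> 0 < nxt s \<and> nxt s \<le> s / 2 \<and> P s (nxt s)" using step by metis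
  define s where "s i = (nxt ^^ i) s0" for i
  have Suc: "s (Suc i) = nxt (s i)" for i by (simp add: s_def)
  have pos: "0 < s i" for i
  proof (induction i)
    case 0 then show ?case using assms by (simp add: s_def)
  next
    case (Suc i) then show ?case using nxt \<open>s (Suc i) = nxt (s i)\<close> by simp
  qed
  have le: "s i \<le> s0 * (1/2) ^ i" for i
  proof (induction i)
    case 0 then show ?case by (simp add: s_def)
  next
    case (Suc i) then show ?case using nxt[OF pos[of i]] \<open>s (Suc i) = nxt (s i)\<close> by simp
  qed
  have lim: "(\<lambda>i. s0 * (1/2) ^ i) \<longlonglongrightarrow> 0"
    by (intro tendsto_mult_right_zero LIMSEQ_power_zero) simp
  have "s \<longlonglongrightarrow> 0"
    by (rule tendsto_sandwich[OF _ _ tendsto_const lim]) (use pos le in \<open>auto intro: always_eventually less_imp_le\<close>)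
  moreover have "s (Suc i) \<le> s i" for i using nxt[OF pos[of i]] pos[of i] by (simp add: Suc)
  ultimately show thesis using that[of s] pos nxt Suc by (simp add: s_def)
qed

context elementary_group begin

lemma coordinate_map_reindex:
  assumes \<phi>: "coordinate_map W U B \<phi>" and U: "U \<subseteq> carrier G" and I: "I \<approx> B"
  shows "\<exists>\<psi>. coordinate_map W U I \<psi>"
proof -
  let ?B = "sum_group B (\<lambda>_. Fp p)" and ?I = "sum_group I (\<lambda>_. Fp p)"
  interpret SB: group ?B by simp
  obtain h where h: "bij_betw h I B" using I by (auto simp: eqpoll_def)
  define e where "e = (\<lambda>u. \<lambda>i\<in>I. u (h i) :: int)"
  have e: "e \<in> iso ?B ?I" unfolding e_def by (rule iso_sum_group_reindex[OF h]) simp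
  then have bij: "bij_betw e (carrier ?B) (carrier ?I)" and hom: "e \<in> hom ?B ?I" by (simp_all add: iso_def)
  have one: "e \<one>\<^bsub>?B\<^esub> = \<one>\<^bsub>?I\<^esub>" by (rule hom_one[OF hom]) simp_all
  have one_iff: "e u = \<one>\<^bsub>?I\<^esub> \<longleftrightarrow> u = \<one>\<^bsub>?B\<^esub>" if "u \<in> carrier ?B" for u
    using bij one that SB.one_closed unfolding bij_betw_def inj_on_def by metis
  have \<phi>c: "\<phi> x \<in> carrier ?B" if "x \<in> carrier G" for x
    using \<phi> that by (auto simp: coordinate_map_def hom_def)
  have "coordinate_map W U I (\<lambda>x. e (\<phi> x))"
    unfolding coordinate_map_def
  proof (intro conjI ballI impI)
    show "(\<lambda>x. e (\<phi> x)) \<in> hom G ?I"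
    proof (rule homI)
      have \<phi>h: "\<phi> \<in> hom G ?B" using \<phi> by (simp add: coordinate_map_def)
      fix x y assume x: "x \<in> carrier G" and y: "y \<in> carrier G"
      show "e (\<phi> x) \<in> carrier ?I" using hom_in_carrier[OF hom \<phi>c[OF x]] .
      show "e (\<phi> (x \<otimes> y)) = e (\<phi> x) \<otimes>\<^bsub>?I\<^esub> e (\<phi> y)"
        using hom_mult[OF \<phi>h x y] hom_mult[OF hom \<phi>c[OF x] \<phi>c[OF y]] by (simp only:)
    qed
    have "(\<lambda>x. e (\<phi> x)) ` U = e ` (\<phi> ` U)" by (simp add: image_image)
    then show "(\<lambda>x. e (\<phi> x)) ` U = carrier ?I"
      using \<phi> bij by (simp add: coordinate_map_def bij_betw_def)
    show "e (\<phi> x) = \<one>\<^bsub>?I\<^esub>" if "x \<in> W" for x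
      using \<phi> that one by (simp add: coordinate_map_def)
    show "x \<in> W" if "x \<in> U" "e (\<phi> x) = \<one>\<^bsub>?I\<^esub>" for x
      using \<phi> that one_iff[OF \<phi>c] U unfolding coordinate_map_def by blast
  qed
  then show ?thesis by blast
qed

lemma coordinate_map_iso:
  assumes "coordinate_map {\<one>} (carrier G) I \<phi>"
  shows "\<phi> \<in> iso G (sum_group I (\<lambda>_. Fp p))"
proof -
  interpret S: group "sum_group I (\<lambda>_. Fp p)" by simp
  interpret h: group_hom G "sum_group I (\<lambda>_. Fp p)" \<phi>
    using assms by unfold_locales (simp_all add: coordinate_map_def)
  show ?thesis
    using assms h.inj_on_one_iff unfolding coordinate_map_def iso_def bij_betw_def by blast
qed

end

section \<open>Classification under saturation\<close>

text \<open>Two more properties of asymptotic cones enter the classification. The cardinality is at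
  most the continuum, and dimensions that are infinite are at least the continuum. The second one is
  stated with a loss of a factor \<open>2\<close> in both radii: this slack makes the diagonal argument for
  ultraproducts insensitive to the boundary values of the norm, and it is harmless because radii can
  be chosen freely in the applications.\<close>

locale saturated_ultrametric_group = ultrametric_group +
  assumes small: "carrier G \<lesssim> eps1"
    and saturated: "\<lbrakk>0 < r; 0 < s; infinite A; A \<subseteq> V r; indep (V s) (\<lambda>b. b) A\<rbrakk>
      \<Longrightarrow> \<exists>A'. A' \<subseteq> V (2 * r) \<and> indep (V (s / 2)) (\<lambda>b. b) A' \<and> eps1 \<lesssim> A'"
begin

lemma indep_empty: "indep W (\<lambda>b. b) {}"
  by (simp add: indep_def)

lemma continuum_indep:
  assumes "\<not> compactin mtopology (V r)" "0 < r"
  obtains s A where "0 < s" "A \<subseteq> V (2 * r)" "indep (V s) (\<lambda>b. b) A" "eps1 \<lesssim> A"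
proof -
  obtain t B where B: "0 < t" "infinite B" "B \<subseteq> V r" "indep (V t) (\<lambda>b. b) B"
    using noncompact_imp_infinite_indep[OF assms(1)] assms(2) by (meson less_imp_le)
  obtain A where "A \<subseteq> V (2 * r)" "indep (V (t / 2)) (\<lambda>b. b) A" "eps1 \<lesssim> A"
    using saturated[OF assms(2) B] by (elim exE conjE)
  then show thesis using that[of "t / 2" A] B(1) by simp
qed

text \<open>The two bounds meet, so every basis containing a large independent set has exactly the
  size of the continuum.\<close>

lemma continuum_basis:
  assumes "A \<subseteq> B" "B \<subseteq> carrier G" "eps1 \<lesssim> A"
  shows "eps1 \<approx> B"
  using assms small by (meson lepoll_antisym lepoll_trans subset_imp_lepoll)

text \<open>Each ball is compact and so contains only finitely many basis elements, which makes the
  basis countable. If it were finite, the whole group would be covered by finitely many balls.\<close>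

lemma countable_basis_of_proper_unbounded:
  assumes proper: "proper_space (carrier G) D" and unbounded: "\<not> mbounded (carrier G)"
    and s: "0 < s" and B: "indep (V s) (\<lambda>b. b) B" "carrier G \<subseteq> span (V s) B"
  shows "eps0 \<approx> B"
proof -
  have Bc: "B \<subseteq> carrier G" using indep_in_carrier[OF B(1)] by auto
  have "finite (B \<inter> V r)" for r
    by (rule compact_imp_finite_indep[of r _ s])
      (use proper s in \<open>simp_all add: proper_iff indep_mono[OF B(1)]\<close>)
  moreover have "B = (\<Union>n::nat. B \<inter> V (real n))"
    using Bc real_arch_simple by (auto simp: V_def subset_iff)
  ultimately have "countable B"
    by (metis countable_UN countable_finite uncountable_def countableI_type)
  moreover have "infinite B"
  proof
    assume "finite B"
    then obtain K where K: "finite K" "K \<subseteq> carrier G" "\<forall>x\<in>carrier G. \<exists>y\<in>K. D y x \<le> s"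
      using finite_basis_imp_cover[OF subgroup_self _ Bc B(2)] by blast
    have "mbounded (\<Union>y\<in>K. mcball y s)" by (rule mbounded_Union) (use K(1) mbounded_mcball in auto)
    moreover have "carrier G \<subseteq> (\<Union>y\<in>K. mcball y s)" using K(2,3) by fastforce
    ultimately show False using unbounded mbounded_subset by blast
  qed
  ultimately show ?thesis
    by (metis countable_infiniteE' eqpoll_def)
qed

lemma discrete_structure:
  assumes B: "coordinate_map {\<one>} (carrier G) B \<phi>" and I: "I \<approx> B"
    and disc: "mtopology = discrete_topology (carrier G)"
  shows "(G, mtopology) \<simeq>\<^sub>t Fdsum p I"
proof -
  obtain \<psi> where "coordinate_map {\<one>} (carrier G) I \<psi>" using coordinate_map_reindex[OF B _ I] by blast
  then have "\<psi> \<in> iso G (sum_group I (\<lambda>_. Fp p))" by (rule coordinate_map_iso)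
  then show ?thesis
    using iso_imp_discrete_iso disc by (simp add: Fdsum_def discrete_group_def)
qed

text \<open>The filtration starts with the compact ball of radius \<open>s0\<close>, with discrete quotient
  of basis \<open>B0\<close>. All further layers are finite by compactness, and they can be chosen nontrivial
  because the group is not discrete. So the ball is a product of countably infinitely many
  groups of order \<open>p\<close>.\<close>

lemma locally_compact_structure:
  fixes B0 :: "'a set" and I :: "'j set"
  assumes nondiscrete: "mtopology \<noteq> discrete_topology (carrier G)"
    and s0: "0 < s0" "compactin mtopology (V s0)"
    and B0: "coordinate_map (V s0) (carrier G) B0 \<phi>0" and I: "I \<approx> B0"
  shows "(G, mtopology) \<simeq>\<^sub>t Fprod p eps0 \<times>\<^sub>t Fdsum p I"
proof -
  have step: "\<exists>t. 0 < t \<and> t \<le> s / 2 \<and> \<not> V s \<subseteq> V t" if pos: "0 < s" for s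
  proof -
    have "V s \<noteq> {\<one>}" using nondiscrete discrete_iff that by blast
    then obtain x where x: "x \<in> V s" "x \<noteq> \<one>" using one_in_V[OF less_imp_le[OF pos]] by blast
    have xc: "x \<in> carrier G" using x V_subset by blast
    then have "0 < D x \<one>" using x by simp
    moreover have "x \<notin> V (min (s/2) (D x \<one> / 2))" using calculation by (auto simp: V_def)
    ultimately show ?thesis using that x(1) by (intro exI[of _ "min (s/2) (D x \<one> / 2)"]) auto
  qed
  obtain s where s: "s 0 = s0" "\<And>i. 0 < s i" "\<And>i. s (Suc i) \<le> s i"
    "\<And>i. \<not> V (s i) \<subseteq> V (s (Suc i))" "s \<longlonglongrightarrow> 0"
    using halving_sequence[OF step s0(1)] by blast
  have "\<exists>(B :: 'a set) \<phi>. finite B \<and> B \<noteq> {} \<and> coordinate_map (V (s (Suc i))) (V (s i)) B \<phi>" for i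
  proof -
    obtain B \<phi> where B: "B \<subseteq> V (s i)" "indep (V (s (Suc i))) (\<lambda>b. b) B" "coordinate_map (V (s (Suc i))) (V (s i)) B \<phi>"
      using coordinate_map_exists[OF subgroup_V subgroup_V empty_subsetI indep_empty] s(2)
      by (metis less_imp_le)
    have "V (s i) \<subseteq> V s0" using s(1) V_mono lift_Suc_antimono_le[of s 0 i] s(3) by simp
    then have "finite B"
      using compact_imp_finite_indep[OF s0(2) _ B(2) s(2)] B(1) by blast
    moreover have "B \<noteq> {}"
    proof
      assume "B = {}"
      then have "\<phi> x = \<one>\<^bsub>sum_group B (\<lambda>_. Fp p)\<^esub>" if "x \<in> V (s i)" for x
      proof -
        have "\<phi> x \<in> carrier (sum_group B (\<lambda>_. Fp p))" using B(3) that unfolding coordinate_map_def by blast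
        then show ?thesis using \<open>B = {}\<close> by (simp add: carrier_Fsum fun_eq_iff)
      qed
      then have "V (s i) \<subseteq> V (s (Suc i))" using B(3) unfolding coordinate_map_def by blast
      then show False using s(4) by blast
    qed
    ultimately show ?thesis using B(3) by blast
  qed
  then obtain B :: "nat \<Rightarrow> 'a set" and \<phi> where B: "\<And>i. finite (B i)" "\<And>i. B i \<noteq> {}"
    "\<And>i. coordinate_map (V (s (Suc i))) (V (s i)) (B i) (\<phi> i)" by metis
  define W where "W = (\<lambda>i. case i of 0 \<Rightarrow> carrier G | Suc j \<Rightarrow> V (s j))"
  define C where "C = (\<lambda>i. case i of 0 \<Rightarrow> B0 | Suc j \<Rightarrow> B j)"
  define \<psi> where "\<psi> = (\<lambda>i. case i of 0 \<Rightarrow> \<phi>0 | Suc j \<Rightarrow> \<phi> j)"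
  have \<psi>: "coordinate_map (W (Suc i)) (W i) (C i) (\<psi> i)" for i
    using B0 B(3) s(1) by (cases i) (simp_all add: W_def C_def \<psi>_def)
  have "(G, mtopology) \<simeq>\<^sub>t (product_group UNIV (\<lambda>i. sum_group (C i) (\<lambda>_. Fp p)),
      product_topology (\<lambda>i. discrete_topology (carrier (sum_group (C i) (\<lambda>_. Fp p)))) UNIV)"
  proof (rule product_decomposition[where s = s and W = W and \<phi> = \<psi>])
    show "\<psi> i \<in> hom G (sum_group (C i) (\<lambda>_. Fp p))" "\<psi> i ` W i = carrier (sum_group (C i) (\<lambda>_. Fp p))" for i
      using \<psi>[of i] by (simp_all add: coordinate_map_def)
    show "\<psi> i x = \<one>\<^bsub>sum_group (C i) (\<lambda>_. Fp p)\<^esub>" if "x \<in> W (Suc i)" for i x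
      using \<psi>[of i] that unfolding coordinate_map_def by blast
    show "x \<in> W (Suc i)" if "x \<in> W i" "\<psi> i x = \<one>\<^bsub>sum_group (C i) (\<lambda>_. Fp p)\<^esub>" for i x
      using \<psi>[of i] that unfolding coordinate_map_def by blast
  qed (simp_all add: s W_def)
  moreover have "\<exists>h. bij_betw h eps0 (Sigma {0<..} C)"
  proof -
    have finC: "finite (C i)" if "0 < i" for i using that B(1) by (cases i) (auto simp: C_def)
    then have "countable (Sigma {0<..} C)" by (intro countable_SIGMA) (auto intro: countable_finite)
    moreover have "infinite (Sigma {0<..} C)"
    proof
      assume "finite (Sigma {0<..} C)"
      then have "finite (fst ` Sigma {0<..} C)" by simp
      moreover have "fst ` Sigma {0<..} C = {0<..}"
      proof
        show "{0<..} \<subseteq> fst ` Sigma {0<..} C"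
        proof
          fix i :: nat assume "i \<in> {0<..}"
          then obtain j where "i = Suc j" by (auto simp: gr0_conv_Suc)
          then obtain b where "b \<in> C i" using B(2)[of j] by (auto simp: C_def)
          then show "i \<in> fst ` Sigma {0<..} C" using \<open>i \<in> {0<..}\<close> by force
        qed
      qed auto
      ultimately show False using range_inj_infinite[OF inj_Suc] by (simp add: greaterThan_0)
    qed
    ultimately show ?thesis by (metis countable_infiniteE')
  qed
  moreover have "\<exists>k. bij_betw k I (C 0)" using I by (simp add: eqpoll_def C_def)
  ultimately show ?thesis
    using regroup_product[OF p_pos, of C _ _ I] B(1)
    by (elim exE) (rule topgroup_iso_trans, assumption, rule regroup_product[OF p_pos],
      auto simp: C_def gr0_conv_Suc)
qed

text \<open>No ball is compact, so the radii can be chosen such that each layer has a basis of the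
  size of the continuum. This includes the top layer, the quotient of the whole group by the first
  ball, which therefore needs no separate factor.\<close>

lemma non_locally_compact_structure:
  assumes "\<not> locally_compact_space mtopology"
  shows "(G, mtopology) \<simeq>\<^sub>t power_group (Fdsum p eps1) eps0"
proof -
  have step: "\<exists>t. 0 < t \<and> t \<le> s / 2 \<and> (\<exists>A. A \<subseteq> V s \<and> indep (V t) (\<lambda>b. b) A \<and> eps1 \<lesssim> A)" if s: "0 < s" for s
  proof -
    have "\<not> compactin mtopology (V (s / 2))" using assms locally_compact_iff s by (meson half_gt_zero)
    then obtain t A where tA: "0 < t" "A \<subseteq> V (2 * (s / 2))" "indep (V t) (\<lambda>b. b) A" "eps1 \<lesssim> A"
      using continuum_indep s by (metis half_gt_zero)
    have "indep (V (min t (s / 2))) (\<lambda>b. b) A"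
      by (rule indep_mono[OF tA(3)]) (simp_all add: V_mono)
    then show ?thesis
      using tA s by (intro exI[of _ "min t (s / 2)"]) auto
  qed
  obtain s where s: "s 0 = 1" "\<And>i. 0 < s i" "\<And>i. s (Suc i) \<le> s i"
    "\<And>i. \<exists>A. A \<subseteq> V (s i) \<and> indep (V (s (Suc i))) (\<lambda>b. b) A \<and> eps1 \<lesssim> A" "s \<longlonglongrightarrow> 0"
    using halving_sequence[OF step, of 1] zero_less_one by blast
  \<comment> \<open>The layers have to contain the balls \<open>V (s i)\<close>; for \<open>i = 0\<close> the ball is enlarged to the whole group.\<close>
  define W where "W = (\<lambda>i. case i of 0 \<Rightarrow> carrier G | Suc j \<Rightarrow> V (s (Suc j)))"
  have W: "W 0 = carrier G" "W (Suc i) = V (s (Suc i))" for i by (simp_all add: W_def)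
  have VW: "V (s i) \<subseteq> W i" for i using V_subset by (cases i) (simp_all add: W_def)
  have sub: "subgroup (W i) G" for i
    using subgroup_self subgroup_V s(2) by (cases i) (auto simp: W less_imp_le)
  have "\<exists>\<phi> :: 'a \<Rightarrow> nat set \<Rightarrow> int. coordinate_map (W (Suc i)) (W i) eps1 \<phi>" for i
  proof -
    obtain A where A: "A \<subseteq> V (s i)" "indep (W (Suc i)) (\<lambda>b. b) A" "eps1 \<lesssim> A"
      using s(4)[of i] by (auto simp: W)
    have "A \<subseteq> W i" using A(1) VW by blast
    then obtain B \<phi> where B: "A \<subseteq> B" "B \<subseteq> W i" "coordinate_map (W (Suc i)) (W i) B \<phi>"
      using coordinate_map_exists[OF sub sub _ A(2)] by metis
    have "eps1 \<approx> B"
      by (rule continuum_basis[OF B(1) _ A(3)]) (use B(2) subgroup.subset[OF sub] in blast)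
    then show ?thesis using coordinate_map_reindex[OF B(3) subgroup.subset[OF sub]] by blast
  qed
  then obtain \<phi> :: "nat \<Rightarrow> 'a \<Rightarrow> nat set \<Rightarrow> int"
    where \<phi>: "\<And>i. coordinate_map (W (Suc i)) (W i) eps1 (\<phi> i)" by metis
  have "(G, mtopology) \<simeq>\<^sub>t (product_group eps0 (\<lambda>i. sum_group eps1 (\<lambda>_. Fp p)),
      product_topology (\<lambda>i. discrete_topology (carrier (sum_group eps1 (\<lambda>_. Fp p)))) eps0)"
  proof (rule product_decomposition[where s = "\<lambda>i. s (Suc i)" and W = W and \<phi> = \<phi>])
    show "\<phi> i \<in> hom G (sum_group eps1 (\<lambda>_. Fp p))" "\<phi> i ` W i = carrier (sum_group eps1 (\<lambda>_. Fp p))" for i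
      using \<phi>[of i] by (simp_all add: coordinate_map_def)
    show "\<phi> i x = \<one>\<^bsub>sum_group eps1 (\<lambda>_. Fp p)\<^esub>" if "x \<in> W (Suc i)" for i x
      using \<phi>[of i] that unfolding coordinate_map_def by blast
    show "x \<in> W (Suc i)" if "x \<in> W i" "\<phi> i x = \<one>\<^bsub>sum_group eps1 (\<lambda>_. Fp p)\<^esub>" for i x
      using \<phi>[of i] that unfolding coordinate_map_def by blast
  qed (simp_all add: s W LIMSEQ_Suc)
  then show ?thesis by (simp add: power_group_def Fdsum_def discrete_group_def)
qed

text \<open>The empty basis of the group modulo itself; it accounts for the discrete factor of a
  compact group.\<close>

lemma coordinate_map_trivial: "coordinate_map (carrier G) (carrier G) ({} :: 'a set) (\<lambda>_. \<one>\<^bsub>sum_group ({} :: 'a set) (\<lambda>_. Fp p)\<^esub>)"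
  by (auto simp: coordinate_map_def hom_def carrier_Fsum fun_eq_iff)

text \<open>If the group is not proper, some ball is not compact, which produces an independent set of the size of the continuum. It remains independent
  modulo smaller balls, so it can be combined with the compact or trivial ball at hand.\<close>

theorem classification:
  defines "T \<equiv> mtopology" and "bounded_G \<equiv> mbounded (carrier G)"
    and "proper_G \<equiv> proper_space (carrier G) D"
    and "discrete_G \<equiv> mtopology = discrete_topology (carrier G)"
  shows "discrete_G \<Longrightarrow> bounded_G \<Longrightarrow> proper_G \<Longrightarrow> \<exists>n::nat. (G, T) \<simeq>\<^sub>t Fprod p {..<n}"
    and "discrete_G \<Longrightarrow> \<not> bounded_G \<Longrightarrow> proper_G \<Longrightarrow> (G, T) \<simeq>\<^sub>t Fdsum p eps0"
    and "discrete_G \<Longrightarrow> \<not> proper_G \<Longrightarrow> (G, T) \<simeq>\<^sub>t Fdsum p eps1"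
    and "locally_compact_space T \<Longrightarrow> \<not> discrete_G \<Longrightarrow> compact_space T \<Longrightarrow> (G, T) \<simeq>\<^sub>t Fprod p eps0"
    and "locally_compact_space T \<Longrightarrow> \<not> discrete_G \<Longrightarrow> \<not> bounded_G \<Longrightarrow> proper_G
      \<Longrightarrow> (G, T) \<simeq>\<^sub>t Fprod p eps0 \<times>\<^sub>t Fdsum p eps0"
    and "locally_compact_space T \<Longrightarrow> \<not> discrete_G \<Longrightarrow> \<not> proper_G
      \<Longrightarrow> (G, T) \<simeq>\<^sub>t Fprod p eps0 \<times>\<^sub>t Fdsum p eps1"
proof -
  have noncompact: "\<exists>s A. 0 < s \<and> A \<subseteq> carrier G \<and> indep (V s) (\<lambda>b. b) A \<and> eps1 \<lesssim> A"
    if np: "\<not> proper_G"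
  proof -
    obtain r where r: "\<not> compactin mtopology (V r)" using np unfolding proper_G_def proper_iff by blast
    have "\<not> compactin mtopology (V (max r 1))"
      using r closed_compactin[OF _ V_mono[of r "max r 1"] closedin_V] by auto
    moreover have "0 < max r 1" by simp
    ultimately obtain s A where "0 < s" "A \<subseteq> V (2 * max r 1)" "indep (V s) (\<lambda>b. b) A" "eps1 \<lesssim> A"
      by (rule continuum_indep)
    then show ?thesis using V_subset by blast
  qed
  {
    assume disc: "discrete_G"
    then obtain s where s: "0 < s" "V s = {\<one>}" unfolding discrete_G_def discrete_iff by blast
    have sub: "subgroup {\<one>} G" using subgroup_V[of s] s by simp
    show "\<exists>n::nat. (G, T) \<simeq>\<^sub>t Fprod p {..<n}" if bd: "bounded_G" and pr: "proper_G"
    proof -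
      obtain B \<phi> where B: "{} \<subseteq> B" "B \<subseteq> carrier G" "indep {\<one>} (\<lambda>b. b) B"
          "carrier G \<subseteq> span {\<one>} B" "coordinate_map {\<one>} (carrier G) B \<phi>"
        by (rule coordinate_map_exists[OF sub subgroup_self empty_subsetI indep_empty])
      obtain r where r: "V r = carrier G" using bd unfolding bounded_G_def bounded_iff by blast
      have "compactin mtopology (V r)" using pr unfolding proper_G_def proper_iff by simp
      then have "finite B"
        by (rule compact_imp_finite_indep[of r B s]) (use B(2,3) s r in simp_all)
      then have "{..<card B} \<approx> B" by (metis eqpoll_iff_card finite_lessThan card_lessThan)
      then have "(G, T) \<simeq>\<^sub>t Fdsum p {..<card B}"
        unfolding T_def by (rule discrete_structure[OF B(5) _ disc[unfolded discrete_G_def]])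
      then show ?thesis using topgroup_iso_trans[OF _ finite_Fdsum_iso_Fprod[OF finite_lessThan p_pos]] by blast
    qed
    show "(G, T) \<simeq>\<^sub>t Fdsum p eps0" if "\<not> bounded_G" "proper_G"
    proof -
      obtain B \<phi> where B: "{} \<subseteq> B" "B \<subseteq> carrier G" "indep {\<one>} (\<lambda>b. b) B"
          "carrier G \<subseteq> span {\<one>} B" "coordinate_map {\<one>} (carrier G) B \<phi>"
        by (rule coordinate_map_exists[OF sub subgroup_self empty_subsetI indep_empty])
      have "eps0 \<approx> B"
        by (rule countable_basis_of_proper_unbounded[OF _ _ s(1)])
          (use that B(3,4) s(2) in \<open>simp_all add: bounded_G_def proper_G_def\<close>)
      then show ?thesis
        unfolding T_def by (rule discrete_structure[OF B(5) _ disc[unfolded discrete_G_def]])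
    qed
    show "(G, T) \<simeq>\<^sub>t Fdsum p eps1" if np: "\<not> proper_G"
    proof -
      obtain t A where A: "0 < t" "A \<subseteq> carrier G" "indep (V t) (\<lambda>b. b) A" "eps1 \<lesssim> A"
        using noncompact[OF np] by (elim exE conjE)
      have "indep {\<one>} (\<lambda>b. b) A" by (rule indep_mono[OF A(3)]) (use A(1) one_in_V in auto)
      then obtain B \<phi> where B: "A \<subseteq> B" "B \<subseteq> carrier G" "indep {\<one>} (\<lambda>b. b) B"
          "carrier G \<subseteq> span {\<one>} B" "coordinate_map {\<one>} (carrier G) B \<phi>"
        by (rule coordinate_map_exists[OF sub subgroup_self A(2)])
      show ?thesis unfolding T_def
        by (rule discrete_structure[OF B(5) continuum_basis[OF B(1,2) A(4)] disc[unfolded discrete_G_def]])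
    qed
  }
  {
    assume lc: "locally_compact_space T" and nd: "\<not> discrete_G"
    obtain s where s: "0 < s" "compactin mtopology (V s)"
      using lc unfolding T_def locally_compact_iff by blast
    show "(G, T) \<simeq>\<^sub>t Fprod p eps0" if C: "compact_space T"
    proof -
      obtain r where r: "0 \<le> r" "V r = carrier G"
        using C unfolding T_def compact_iff bounded_iff by blast
      \<comment> \<open>A positive radius is needed; \<open>r\<close> itself may be zero.\<close>
      have r': "V (r + 1) = carrier G" using V_mono[of r "r + 1"] V_subset[of "r + 1"] r by auto
      have "(G, mtopology) \<simeq>\<^sub>t Fprod p eps0 \<times>\<^sub>t Fdsum p ({} :: 'a set)"
        by (rule locally_compact_structure[of "r + 1" "{}"])
          (use nd r C coordinate_map_trivial in \<open>auto simp: discrete_G_def r' T_def compact_space_def\<close>)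
      then show ?thesis unfolding T_def using Fprod_times_trivial topgroup_iso_trans by blast
    qed
    show "(G, T) \<simeq>\<^sub>t Fprod p eps0 \<times>\<^sub>t Fdsum p eps0" if "\<not> bounded_G" "proper_G"
    proof -
      obtain B \<phi> where B: "{} \<subseteq> B" "B \<subseteq> carrier G" "indep (V s) (\<lambda>b. b) B"
          "carrier G \<subseteq> span (V s) B" "coordinate_map (V s) (carrier G) B \<phi>"
        by (rule coordinate_map_exists[OF subgroup_V[OF less_imp_le[OF s(1)]] subgroup_self empty_subsetI indep_empty])
      have "eps0 \<approx> B"
        by (rule countable_basis_of_proper_unbounded[OF _ _ s(1) B(3,4)])
          (use that in \<open>simp_all add: bounded_G_def proper_G_def\<close>)
      then show ?thesis
        unfolding T_def by (rule locally_compact_structure[OF nd[unfolded discrete_G_def] s B(5)])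
    qed
    show "(G, T) \<simeq>\<^sub>t Fprod p eps0 \<times>\<^sub>t Fdsum p eps1" if np: "\<not> proper_G"
    proof -
      obtain t A where A: "0 < t" "A \<subseteq> carrier G" "indep (V t) (\<lambda>b. b) A" "eps1 \<lesssim> A"
        using noncompact[OF np] by (elim exE conjE)
      define u where "u = min s t"
      have u: "0 < u" "compactin mtopology (V u)"
        using s A(1) closed_compactin[OF s(2) V_mono closedin_V, of u] by (auto simp: u_def)
      have "indep (V u) (\<lambda>b. b) A" by (rule indep_mono[OF A(3)]) (simp_all add: u_def V_mono)
      then obtain B \<phi> where B: "A \<subseteq> B" "B \<subseteq> carrier G" "indep (V u) (\<lambda>b. b) B"
          "carrier G \<subseteq> span (V u) B" "coordinate_map (V u) (carrier G) B \<phi>"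
        by (rule coordinate_map_exists[OF subgroup_V[OF less_imp_le[OF u(1)]] subgroup_self A(2)])
      show ?thesis unfolding T_def
        by (rule locally_compact_structure[OF nd[unfolded discrete_G_def] u B(5) continuum_basis[OF B(1,2) A(4)]])
    qed
  }
qed

end

section \<open>Nonprincipal ultrafilters\<close>

lemma ultrafilter_cases: "ultrafilter_on A \<omega> \<Longrightarrow> (\<forall>\<^sub>F x in \<omega>. P x) \<or> (\<forall>\<^sub>F x in \<omega>. \<not> P x)"
  by (auto simp: ultrafilter_on_def)

text \<open>A nonprincipal ultrafilter contains no singleton, hence no finite set, so it contains
  the complements of all finite sets.\<close>

lemma nonprincipal_ultrafilter_le_sequentially:
  assumes "ultrafilter_on A \<omega>" "nonprincipal \<omega>"
  shows "\<omega> \<le> sequentially"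
proof -
  have ne: "\<forall>\<^sub>F x in \<omega>. x \<noteq> a" for a
  proof (rule ccontr)
    assume "\<not> (\<forall>\<^sub>F x in \<omega>. x \<noteq> a)"
    then have a: "\<forall>\<^sub>F x in \<omega>. x = a" using ultrafilter_cases[OF assms(1), of "\<lambda>x. x = a"] by auto
    have "\<omega> = principal {a}"
    proof (rule filter_eqI)
      fix P
      show "eventually P \<omega> = eventually P (principal {a})"
      proof (cases "P a")
        case True
        then show ?thesis using a by (auto simp: eventually_principal elim: eventually_mono)
      next
        case False
        have "\<not> eventually P \<omega>"
        proof
          assume "eventually P \<omega>"
          then have "\<forall>\<^sub>F x in \<omega>. False" using a by eventually_elim (use False in auto)
          then show False using assms(1) by (simp add: ultrafilter_on_def eventually_False)
        qed
        then show ?thesis using False by (simp add: eventually_principal)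
      qed
    qed
    then show False using assms(2) by (simp add: nonprincipal_def)
  qed
  have "\<forall>\<^sub>F n in \<omega>. N \<le> n" for N
  proof -
    have "\<forall>\<^sub>F n in \<omega>. \<forall>a\<in>{..<N}. n \<noteq> a" by (rule eventually_ball_finite) (use ne in auto)
    then show ?thesis by eventually_elim (auto simp: not_less[symmetric])
  qed
  then have "filterlim (\<lambda>n. n) sequentially \<omega>" by (simp add: filterlim_at_top)
  then show ?thesis by (simp add: filterlim_def filtermap_ident)
qed

lemma ultrafilter_bounded_limit:
  fixes f :: "'a \<Rightarrow> real"
  assumes "ultrafilter_on A \<omega>" "\<forall>\<^sub>F x in \<omega>. f x \<in> {a..b}"
  shows "\<exists>l. (f \<longlongrightarrow> l) \<omega>"
proof -
  have nb: "\<omega> \<noteq> bot" using assms(1) by (simp add: ultrafilter_on_def)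
  have "filtermap f \<omega> \<noteq> bot" using nb by (simp add: filtermap_bot_iff)
  moreover have "\<forall>\<^sub>F y in filtermap f \<omega>. y \<in> {a..b}"
    using assms(2) by (simp add: eventually_filtermap)
  ultimately obtain l where l: "inf (nhds l) (filtermap f \<omega>) \<noteq> bot"
    using compact_Icc[of a b] unfolding compact_filter by meson
  have "(f \<longlongrightarrow> l) \<omega>"
  proof (rule topological_tendstoI)
    fix S assume S: "open S" "l \<in> S"
    show "\<forall>\<^sub>F x in \<omega>. f x \<in> S"
    proof (rule ccontr)
      assume "\<not> (\<forall>\<^sub>F x in \<omega>. f x \<in> S)"
      then have "\<forall>\<^sub>F y in filtermap f \<omega>. y \<notin> S"
        using ultrafilter_cases[OF assms(1), of "\<lambda>x. f x \<in> S"] by (auto simp: eventually_filtermap)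
      moreover have "\<forall>\<^sub>F y in nhds l. y \<in> S" using S by (rule eventually_nhds_in_open)
      ultimately have "eventually (\<lambda>_. False) (inf (nhds l) (filtermap f \<omega>))"
        unfolding eventually_inf by blast
      then show False using l by (simp add: eventually_False)
    qed
  qed
  then show ?thesis by blast
qed

text \<open>Countable saturation in elementary form: countably many conditions each of which holds
  almost everywhere can be met simultaneously, in the sense that at almost every \<open>n\<close> one
  satisfies the condition number \<open>m n\<close>, with \<open>m\<close> tending to infinity. Completeness of the cone
  and largeness of its infinite layers are both obtained in this way.\<close>

lemma diagonal_choice:
  fixes Q :: "nat \<Rightarrow> nat \<Rightarrow> bool" and \<omega> :: "nat filter"
  assumes \<omega>: "\<omega> \<le> sequentially" and Q: "\<And>k. \<forall>\<^sub>F n in \<omega>. Q k n"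
  obtains m where "filterlim m sequentially \<omega>" "\<forall>\<^sub>F n in \<omega>. Q (m n) n"
proof -
  \<comment> \<open>The bound \<open>k \<le> n\<close> makes the maximum exist even where all conditions hold.\<close>
  define S where "S n = {k. k \<le> n \<and> (\<forall>j\<le>k. Q j n)}" for n
  define m where "m n = Max (S n)" for n
  have fin: "finite (S n)" for n by (rule finite_subset[of _ "{..n}"]) (auto simp: S_def)
  have ev: "\<forall>\<^sub>F n in \<omega>. K \<in> S n" for K
  proof -
    have "\<forall>\<^sub>F n in \<omega>. \<forall>j\<in>{..K}. Q j n" by (rule eventually_ball_finite) (use Q in auto)
    moreover have "\<forall>\<^sub>F n in \<omega>. K \<le> n" by (rule filter_leD[OF \<omega> eventually_ge_at_top])
    ultimately show ?thesis by eventually_elim (auto simp: S_def)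
  qed
  have "\<forall>\<^sub>F n in \<omega>. K \<le> m n" for K
    using ev[of K] by eventually_elim (use fin in \<open>auto simp: m_def intro: Max_ge\<close>)
  then have "filterlim m sequentially \<omega>" by (simp add: filterlim_at_top)
  moreover have "\<forall>\<^sub>F n in \<omega>. Q (m n) n"
    using ev[of 0]
  proof eventually_elim
    fix n assume "0 \<in> S n"
    then have "m n \<in> S n" unfolding m_def using fin by (intro Max_in) auto
    then show "Q (m n) n" by (simp add: S_def)
  qed
  ultimately show thesis by (rule that)
qed

section \<open>The asymptotic cone as an ultrametric group\<close>

locale ultrametric_cone = elementary_group X p
  for X :: "('a, 'm) monoid_scheme" (structure) and p :: nat +
  fixes d :: "'a \<Rightarrow> 'a \<Rightarrow> real" and \<omega> :: "nat filter"
  assumes d_nonneg: "\<lbrakk>x \<in> carrier X; y \<in> carrier X\<rbrakk> \<Longrightarrow> 0 \<le> d x y"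
    and d_refl: "x \<in> carrier X \<Longrightarrow> d x x = 0"
    and d_sym: "\<lbrakk>x \<in> carrier X; y \<in> carrier X\<rbrakk> \<Longrightarrow> d x y = d y x"
    and d_ultra: "\<lbrakk>x \<in> carrier X; y \<in> carrier X; z \<in> carrier X\<rbrakk> \<Longrightarrow> d x z \<le> max (d x y) (d y z)"
    and d_invariant: "\<lbrakk>x \<in> carrier X; y \<in> carrier X; z \<in> carrier X\<rbrakk> \<Longrightarrow> d (x \<otimes> z) (y \<otimes> z) = d x y"
    and countable_X: "countable (carrier X)"
    and ultrafilter: "ultrafilter_on {1..} \<omega>"
    and nonprincipal: "nonprincipal \<omega>"
begin

abbreviation L where "L \<equiv> linear_seqs X d"
abbreviation N where "N \<equiv> null_seqs \<omega> X d"
abbreviation C where "C \<equiv> asymp_cone \<omega> X d"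
abbreviation pd where "pd \<equiv> cone_pseudodist \<omega> d"
abbreviation CD where "CD \<equiv> cone_dist \<omega> X d"

lemma \<omega>_ne_bot: "\<omega> \<noteq> bot"
  using ultrafilter by (simp add: ultrafilter_on_def)

lemma \<omega>_le: "\<omega> \<le> sequentially"
  by (rule nonprincipal_ultrafilter_le_sequentially[OF ultrafilter nonprincipal])

lemma eventually_ge: "\<forall>\<^sub>F n in \<omega>. K \<le> n"
  by (rule filter_leD[OF \<omega>_le eventually_ge_at_top])

lemma L_iff: "x \<in> carrier L \<longleftrightarrow> x \<in> {1..} \<rightarrow>\<^sub>E carrier X \<and> (\<exists>K. \<forall>\<^sub>F n in sequentially. d (x n) \<one> \<le> K * real n)"
proof -
  have "limsup (\<lambda>n. ereal (d (x n) \<one> / real n)) < \<infinity> \<longleftrightarrow> (\<exists>K. \<forall>\<^sub>F n in sequentially. d (x n) \<one> \<le> K * real n)" (is "?l = ?r")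
  proof
    assume ?l
    then obtain K :: real where "limsup (\<lambda>n. ereal (d (x n) \<one> / real n)) < ereal K"
      by (metis ereal_dense2)
    then have "\<forall>\<^sub>F n in sequentially. ereal (d (x n) \<one> / real n) < ereal K" by (rule Limsup_lessD)
    then have "\<forall>\<^sub>F n in sequentially. d (x n) \<one> \<le> K * real n"
      using eventually_gt_at_top[of 0] by eventually_elim (simp add: divide_less_eq)
    then show ?r by blast
  next
    assume ?r
    then obtain K where "\<forall>\<^sub>F n in sequentially. d (x n) \<one> \<le> K * real n" by blast
    then have "\<forall>\<^sub>F n in sequentially. ereal (d (x n) \<one> / real n) \<le> ereal K"
      using eventually_gt_at_top[of 0] by eventually_elim (simp add: divide_le_eq)
    then have "limsup (\<lambda>n. ereal (d (x n) \<one> / real n)) \<le> ereal K" by (rule Limsup_bounded)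
    then show ?l by auto
  qed
  then show ?thesis by (simp add: linear_seqs_def)
qed

lemma L_closed: "x \<in> carrier L \<Longrightarrow> 1 \<le> n \<Longrightarrow> x n \<in> carrier X"
  by (auto simp: L_iff)

lemma L_memI:
  assumes "\<And>n. 1 \<le> n \<Longrightarrow> f n \<in> carrier X" "\<forall>\<^sub>F n in sequentially. 1 \<le> n \<longrightarrow> d (f n) \<one> \<le> K * real n"
  shows "(\<lambda>n\<in>{1..}. f n) \<in> carrier L"
  unfolding L_iff
proof (intro conjI exI)
  show "\<forall>\<^sub>F n in sequentially. d ((\<lambda>n\<in>{1..}. f n) n) \<one> \<le> K * real n"
    using assms(2) eventually_ge_at_top[of 1] by eventually_elim simp
qed (use assms(1) in auto)

lemma d_mult_one:
  assumes "x \<in> carrier X" "y \<in> carrier X"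
  shows "d (x \<otimes> y) \<one> \<le> max (d x \<one>) (d y \<one>)"
proof -
  have "d (x \<otimes> y) \<one> \<le> max (d (x \<otimes> y) y) (d y \<one>)" using assms by (intro d_ultra) auto
  moreover have "d (x \<otimes> y) y = d x \<one>" using d_invariant[of x \<one> y] assms by simp
  ultimately show ?thesis by simp
qed

lemma d_inv: "x \<in> carrier X \<Longrightarrow> d (inv x) \<one> = d x \<one>"
  using d_invariant[of "inv x" \<one> x] d_sym[of \<one> x] by simp

lemma subgroup_L: "subgroup (carrier L) (product_group {1..} (\<lambda>_. X))"
proof (rule group.subgroupI)
  show "group (product_group {1..} (\<lambda>_. X))" by simp
  show "carrier L \<subseteq> carrier (product_group {1..} (\<lambda>_. X))" by (auto simp: L_iff)
  have "(\<lambda>n\<in>{1..}. \<one>) \<in> carrier L"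
    by (rule L_memI[where K = 0]) (simp_all add: d_refl)
  then show "carrier L \<noteq> {}" by blast
  fix x assume x: "x \<in> carrier L"
  obtain K where K: "\<forall>\<^sub>F n in sequentially. d (x n) \<one> \<le> K * real n" using x by (auto simp: L_iff)
  have "(\<lambda>n\<in>{1..}. inv (x n)) \<in> carrier L"
  proof (rule L_memI)
    show "\<forall>\<^sub>F n in sequentially. 1 \<le> n \<longrightarrow> d (inv (x n)) \<one> \<le> K * real n"
      using K by eventually_elim (simp add: d_inv L_closed[OF x])
  qed (simp add: L_closed[OF x])
  then show "inv\<^bsub>product_group {1..} (\<lambda>_. X)\<^esub> x \<in> carrier L"
    using x by (subst inv_product_group) (auto simp: L_iff)
  fix y assume y: "y \<in> carrier L"
  obtain K' where K': "\<forall>\<^sub>F n in sequentially. d (y n) \<one> \<le> K' * real n" using y by (auto simp: L_iff)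
  have "\<forall>\<^sub>F n in sequentially. 1 \<le> n \<longrightarrow> d (x n \<otimes> y n) \<one> \<le> max K K' * real n"
    using K K' eventually_ge_at_top[of 1]
  proof eventually_elim
    fix n :: nat assume n: "d (x n) \<one> \<le> K * real n" "d (y n) \<one> \<le> K' * real n" "1 \<le> n"
    have "d (x n \<otimes> y n) \<one> \<le> max (d (x n) \<one>) (d (y n) \<one>)"
      using L_closed[OF x n(3)] L_closed[OF y n(3)] by (rule d_mult_one)
    also have "\<dots> \<le> max (K * real n) (K' * real n)" using n by auto
    also have "\<dots> = max K K' * real n" by (simp add: max_mult_distrib_right)
    finally show "1 \<le> n \<longrightarrow> d (x n \<otimes> y n) \<one> \<le> max K K' * real n" by simp
  qed
  then have "(\<lambda>n\<in>{1..}. x n \<otimes> y n) \<in> carrier L"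
    by (rule L_memI[rotated]) (simp add: L_closed[OF x] L_closed[OF y])
  then show "x \<otimes>\<^bsub>product_group {1..} (\<lambda>_. X)\<^esub> y \<in> carrier L" by simp
qed

lemma L_eq: "L = (product_group {1..} (\<lambda>_. X))\<lparr>carrier := carrier L\<rparr>"
  by (simp add: linear_seqs_def)

lemma L_mult: "x \<otimes>\<^bsub>L\<^esub> y = (\<lambda>n\<in>{1..}. x n \<otimes> y n)"
  by (simp add: linear_seqs_def)

lemma L_mult_apply: "1 \<le> n \<Longrightarrow> (x \<otimes>\<^bsub>L\<^esub> y) n = x n \<otimes> y n"
  by (simp add: L_mult)

lemma L_one: "\<one>\<^bsub>L\<^esub> = (\<lambda>n\<in>{1..}. \<one>)"
  by (simp add: linear_seqs_def)

sublocale L: comm_group L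
proof (rule group.group_comm_groupI)
  show "group L" by (subst L_eq) (rule subgroup.subgroup_is_group[OF subgroup_L], simp)
  fix x y assume "x \<in> carrier L" "y \<in> carrier L"
  then show "x \<otimes>\<^bsub>L\<^esub> y = y \<otimes>\<^bsub>L\<^esub> x"
    using L_closed m_comm by (auto simp: L_mult fun_eq_iff)
qed

lemma eval_hom: "1 \<le> n \<Longrightarrow> group_hom L X (\<lambda>x. x n)"
  by unfold_locales (auto simp: hom_def L_closed L_mult)

text \<open>The limit exists because sequences of linear growth have bounded ratios, and bounded
  functions converge along ultrafilters.\<close>

lemma pd_tendsto:
  assumes x: "x \<in> carrier L" and y: "y \<in> carrier L"
  shows "((\<lambda>n. d (x n) (y n) / real n) \<longlongrightarrow> pd x y) \<omega>"
proof -
  obtain K K' where K: "\<forall>\<^sub>F n in sequentially. d (x n) \<one> \<le> K * real n" "\<forall>\<^sub>F n in sequentially. d (y n) \<one> \<le> K' * real n"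
    using x y by (auto simp: L_iff)
  have "\<forall>\<^sub>F n in \<omega>. d (x n) (y n) / real n \<in> {0..max K K'}"
    using filter_leD[OF \<omega>_le K(1)] filter_leD[OF \<omega>_le K(2)] eventually_ge[of 1]
  proof eventually_elim
    fix n :: nat assume n: "d (x n) \<one> \<le> K * real n" "d (y n) \<one> \<le> K' * real n" "1 \<le> n"
    have xy: "x n \<in> carrier X" "y n \<in> carrier X" using L_closed x y n(3) by auto
    have "d (x n) (y n) \<le> max (d (x n) \<one>) (d \<one> (y n))" using xy by (intro d_ultra) auto
    also have "\<dots> \<le> max (K * real n) (K' * real n)" using n d_sym[of \<one> "y n"] xy by auto
    also have "\<dots> = max K K' * real n" by (simp add: max_mult_distrib_right)
    finally show "d (x n) (y n) / real n \<in> {0..max K K'}"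
      using n(3) d_nonneg[OF xy] by (simp add: divide_le_eq)
  qed
  from ultrafilter_bounded_limit[OF ultrafilter this]
  obtain l where "((\<lambda>n. d (x n) (y n) / real n) \<longlongrightarrow> l) \<omega>" ..
  then show ?thesis unfolding cone_pseudodist_def using tendsto_Lim \<omega>_ne_bot by metis
qed

lemma pd_le:
  assumes "x \<in> carrier L" "y \<in> carrier L" "\<forall>\<^sub>F n in \<omega>. d (x n) (y n) \<le> K * real n"
  shows "pd x y \<le> K"
proof (rule tendsto_upperbound[OF pd_tendsto[OF assms(1,2)] _ \<omega>_ne_bot])
  show "\<forall>\<^sub>F n in \<omega>. d (x n) (y n) / real n \<le> K"
    using assms(3) eventually_ge[of 1] by eventually_elim (simp add: divide_le_eq)
qed

lemma pd_ge:
  assumes "x \<in> carrier L" "y \<in> carrier L" "\<forall>\<^sub>F n in \<omega>. K * real n \<le> d (x n) (y n)"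
  shows "K \<le> pd x y"
proof (rule tendsto_lowerbound[OF pd_tendsto[OF assms(1,2)] _ \<omega>_ne_bot])
  show "\<forall>\<^sub>F n in \<omega>. K \<le> d (x n) (y n) / real n"
    using assms(3) eventually_ge[of 1] by eventually_elim (simp add: le_divide_eq)
qed

lemma pd_lessD:
  assumes "x \<in> carrier L" "y \<in> carrier L" "pd x y < K"
  shows "\<forall>\<^sub>F n in \<omega>. d (x n) (y n) < K * real n"
  using order_tendstoD(2)[OF pd_tendsto[OF assms(1,2)] assms(3)] eventually_ge[of 1]
  by eventually_elim (simp add: divide_less_eq)

lemma pd_greaterD:
  assumes "x \<in> carrier L" "y \<in> carrier L" "K < pd x y"
  shows "\<forall>\<^sub>F n in \<omega>. K * real n < d (x n) (y n)"
  using order_tendstoD(1)[OF pd_tendsto[OF assms(1,2)] assms(3)] eventually_ge[of 1]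
  by eventually_elim (simp add: less_divide_eq)

lemma pd_nonneg: "\<lbrakk>x \<in> carrier L; y \<in> carrier L\<rbrakk> \<Longrightarrow> 0 \<le> pd x y"
  by (rule pd_ge) (auto intro!: eventually_mono[OF eventually_ge[of 1]] d_nonneg L_closed)

lemma pd_eqI:
  assumes "x \<in> carrier L" "y \<in> carrier L" "x' \<in> carrier L" "y' \<in> carrier L"
    and "\<And>n. 1 \<le> n \<Longrightarrow> d (x n) (y n) = d (x' n) (y' n)"
  shows "pd x y = pd x' y'"
proof (rule tendsto_unique[OF \<omega>_ne_bot pd_tendsto[OF assms(1,2)]])
  show "((\<lambda>n. d (x n) (y n) / real n) \<longlongrightarrow> pd x' y') \<omega>"
    by (rule Lim_transform_eventually[OF pd_tendsto[OF assms(3,4)]])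
      (rule eventually_mono[OF eventually_ge[of 1]], simp add: assms(5))
qed

lemma pd_sym: "\<lbrakk>x \<in> carrier L; y \<in> carrier L\<rbrakk> \<Longrightarrow> pd x y = pd y x"
  by (rule pd_eqI) (simp_all add: d_sym L_closed)

lemma pd_refl: "x \<in> carrier L \<Longrightarrow> pd x x = 0"
proof -
  assume x: "x \<in> carrier L"
  have "pd x x \<le> 0" by (rule pd_le[OF x x]) (auto intro!: eventually_mono[OF eventually_ge[of 1]] simp: d_refl L_closed[OF x])
  then show ?thesis using pd_nonneg[OF x x] by simp
qed

lemma pd_invariant:
  "\<lbrakk>x \<in> carrier L; y \<in> carrier L; z \<in> carrier L\<rbrakk> \<Longrightarrow> pd (x \<otimes>\<^bsub>L\<^esub> z) (y \<otimes>\<^bsub>L\<^esub> z) = pd x y"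
  by (rule pd_eqI) (simp_all add: L_mult_apply d_invariant L_closed)

lemma pd_ultra:
  assumes "x \<in> carrier L" "y \<in> carrier L" "z \<in> carrier L"
  shows "pd x z \<le> max (pd x y) (pd y z)"
proof (rule tendsto_le[OF \<omega>_ne_bot tendsto_max[OF pd_tendsto[OF assms(1,2)] pd_tendsto[OF assms(2,3)]] pd_tendsto[OF assms(1,3)]])
  show "\<forall>\<^sub>F n in \<omega>. d (x n) (z n) / real n \<le> max (d (x n) (y n) / real n) (d (y n) (z n) / real n)"
    using eventually_ge[of 1]
  proof eventually_elim
    fix n :: nat assume n: "1 \<le> n"
    have "d (x n) (z n) \<le> max (d (x n) (y n)) (d (y n) (z n))"
      using assms n by (intro d_ultra) (auto intro: L_closed)
    then show "d (x n) (z n) / real n \<le> max (d (x n) (y n) / real n) (d (y n) (z n) / real n)"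
      by (auto simp: le_max_iff_disj divide_right_mono)
  qed
qed

lemma N_iff: "x \<in> N \<longleftrightarrow> x \<in> carrier L \<and> pd x \<one>\<^bsub>L\<^esub> = 0"
  by (simp add: null_seqs_def)

lemma pd_quotient: "\<lbrakk>x \<in> carrier L; y \<in> carrier L\<rbrakk> \<Longrightarrow> pd (x \<otimes>\<^bsub>L\<^esub> inv\<^bsub>L\<^esub> y) \<one>\<^bsub>L\<^esub> = pd x y"
  using pd_invariant[of x y "inv\<^bsub>L\<^esub> y"] by simp

lemma subgroup_N: "subgroup N L"
proof (rule L.subgroupI)
  show "N \<subseteq> carrier L" by (auto simp: N_iff)
  have "\<one>\<^bsub>L\<^esub> \<in> N" by (simp add: N_iff pd_refl)
  then show "N \<noteq> {}" by blast
  fix x assume x: "x \<in> N"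
  then show "inv\<^bsub>L\<^esub> x \<in> N"
    using pd_quotient[of "\<one>\<^bsub>L\<^esub>" x] pd_sym[of "\<one>\<^bsub>L\<^esub>" x] by (simp add: N_iff)
  fix y assume y: "y \<in> N"
  have xy: "x \<in> carrier L" "y \<in> carrier L" "pd x \<one>\<^bsub>L\<^esub> = 0" "pd y \<one>\<^bsub>L\<^esub> = 0" using x y by (auto simp: N_iff)
  have "pd (x \<otimes>\<^bsub>L\<^esub> y) y = 0" using pd_invariant[of x "\<one>\<^bsub>L\<^esub>" y] xy by simp
  then have "pd (x \<otimes>\<^bsub>L\<^esub> y) \<one>\<^bsub>L\<^esub> \<le> 0" using pd_ultra[of "x \<otimes>\<^bsub>L\<^esub> y" y "\<one>\<^bsub>L\<^esub>"] xy by simp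
  then show "x \<otimes>\<^bsub>L\<^esub> y \<in> N" using xy pd_nonneg[of "x \<otimes>\<^bsub>L\<^esub> y" "\<one>\<^bsub>L\<^esub>"] by (simp add: N_iff)
qed

definition cls :: "(nat \<Rightarrow> 'a) \<Rightarrow> (nat \<Rightarrow> 'a) set" where
  "cls x = N #>\<^bsub>L\<^esub> x"

lemma comm_group_C: "comm_group C"
  unfolding asymp_cone_def by (rule L.abelian_FactGroup[OF subgroup_N])

sublocale C: comm_group C by (rule comm_group_C)

lemma carrier_C: "carrier C = cls ` carrier L"
  by (simp add: asymp_cone_def carrier_FactGroup cls_def image_def)

lemma cls_hom: "group_hom L C cls"
proof -
  interpret normal N L using subgroup_N by (simp add: L.normal_iff_subgroup)
  have "cls = (\<lambda>a. N #>\<^bsub>L\<^esub> a)" by (simp add: cls_def fun_eq_iff)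
  then have "cls \<in> hom L C" unfolding asymp_cone_def using r_coset_hom_Mod by simp
  then show ?thesis by unfold_locales
qed

sublocale cls: group_hom L C cls by (rule cls_hom)

lemma C_cases:
  assumes "A \<in> carrier C"
  obtains x where "x \<in> carrier L" "A = cls x"
  using assms carrier_C by auto

lemma mem_cls: "x \<in> carrier L \<Longrightarrow> y \<in> cls x \<longleftrightarrow> y \<in> carrier L \<and> pd y x = 0"
proof
  assume x: "x \<in> carrier L" and "y \<in> cls x"
  then obtain z where z: "z \<in> N" "y = z \<otimes>\<^bsub>L\<^esub> x" by (auto simp: cls_def r_coset_def)
  then show "y \<in> carrier L \<and> pd y x = 0"
    using x pd_invariant[of z "\<one>\<^bsub>L\<^esub>" x] by (auto simp: N_iff)
next
  assume x: "x \<in> carrier L" and y: "y \<in> carrier L \<and> pd y x = 0"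
  then have "y \<otimes>\<^bsub>L\<^esub> inv\<^bsub>L\<^esub> x \<in> N" by (simp add: N_iff pd_quotient)
  moreover have "y = (y \<otimes>\<^bsub>L\<^esub> inv\<^bsub>L\<^esub> x) \<otimes>\<^bsub>L\<^esub> x" using x y by (simp add: L.m_assoc)
  ultimately show "y \<in> cls x" unfolding cls_def r_coset_def by blast
qed

lemma cls_self: "x \<in> carrier L \<Longrightarrow> x \<in> cls x"
  by (simp add: mem_cls pd_refl)

lemma cls_eq_iff: "\<lbrakk>x \<in> carrier L; y \<in> carrier L\<rbrakk> \<Longrightarrow> cls x = cls y \<longleftrightarrow> pd x y = 0"
proof
  assume x: "x \<in> carrier L" and y: "y \<in> carrier L"
  then show "pd x y = 0" if "cls x = cls y" using that cls_self[OF x] by (simp add: mem_cls)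
  assume "pd x y = 0"
  then have "x \<in> N #>\<^bsub>L\<^esub> y" using x y mem_cls[of y x] by (simp add: cls_def)
  then show "cls x = cls y" using L.repr_independence[OF _ y subgroup_N] by (simp add: cls_def)
qed

text \<open>The distance of two cosets is computed by any representatives: by the ultrametric
  inequality, changing them by null sequences does not affect the pseudo-distance.\<close>

lemma CD_cls:
  assumes x: "x \<in> carrier L" and y: "y \<in> carrier L"
  shows "CD (cls x) (cls y) = pd x y"
proof -
  have eq: "pd a b = pd x y" if "a \<in> cls x" "b \<in> cls y" for a b
  proof -
    have ab: "a \<in> carrier L" "b \<in> carrier L" "pd a x = 0" "pd b y = 0" using that x y by (auto simp: mem_cls)
    have nn: "0 \<le> pd a b" "0 \<le> pd x y" using pd_nonneg ab x y by auto
    have "pd a b \<le> pd x y"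
      using pd_ultra[OF ab(1) x ab(2)] pd_ultra[OF x y ab(2)] pd_sym[OF y ab(2)] ab nn by simp
    moreover have "pd x y \<le> pd a b"
      using pd_ultra[OF x ab(1) y] pd_ultra[OF ab(1,2) y] pd_sym[OF x ab(1)] ab nn by simp
    ultimately show ?thesis by simp
  qed
  have "(\<lambda>(a, b). pd a b) ` (cls x \<times> cls y) = (\<lambda>_. pd x y) ` (cls x \<times> cls y)"
    by (rule image_cong) (use eq in auto)
  also have "\<dots> = {pd x y}" using cls_self[OF x] cls_self[OF y] by auto
  finally have "(\<lambda>(a, b). pd a b) ` (cls x \<times> cls y) = {pd x y}" .
  then show ?thesis using x y by (simp add: cone_dist_def)
qed

lemma CD_outside: "A \<notin> carrier C \<or> B \<notin> carrier C \<Longrightarrow> CD A B = 0"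
  by (auto simp: cone_dist_def)

lemma metric_C: "Metric_space (carrier C) CD"
proof
  show "0 \<le> CD A B" for A B
    by (cases "A \<in> carrier C \<and> B \<in> carrier C") (auto simp: CD_outside CD_cls pd_nonneg elim!: C_cases)
  show "CD A B = CD B A" for A B
    by (cases "A \<in> carrier C \<and> B \<in> carrier C") (auto simp: CD_outside CD_cls pd_sym elim!: C_cases)
  show "CD A B = 0 \<longleftrightarrow> A = B" if AB: "A \<in> carrier C" "B \<in> carrier C" for A B
  proof -
    obtain x y where "x \<in> carrier L" "y \<in> carrier L" "A = cls x" "B = cls y"
      using AB by (meson C_cases)
    then show ?thesis by (simp only: CD_cls cls_eq_iff)
  qed
  show "CD A E \<le> CD A B + CD B E" if AB: "A \<in> carrier C" "B \<in> carrier C" "E \<in> carrier C" for A B E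
  proof -
    obtain x y z where xyz: "x \<in> carrier L" "y \<in> carrier L" "z \<in> carrier L" "A = cls x" "B = cls y" "E = cls z"
      using AB by (meson C_cases)
    then show ?thesis using pd_ultra[of x y z] pd_nonneg[of x y] pd_nonneg[of y z] by (simp add: CD_cls)
  qed
qed

sublocale C: Metric_space "carrier C" CD by (rule metric_C)

lemma elementary_C: "elementary_group C p"
proof -
  have "A [^]\<^bsub>C\<^esub> p = \<one>\<^bsub>C\<^esub>" if A: "A \<in> carrier C" for A
  proof -
    obtain x where x: "x \<in> carrier L" "A = cls x" using A by (rule C_cases)
    have "x [^]\<^bsub>L\<^esub> p = \<one>\<^bsub>L\<^esub>"
    proof
      fix n
      show "(x [^]\<^bsub>L\<^esub> p) n = \<one>\<^bsub>L\<^esub> n"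
      proof (cases "1 \<le> n")
        case True
        interpret e: group_hom L X "\<lambda>x. x n" by (rule eval_hom[OF True])
        show ?thesis using x exponent[OF L_closed[OF x(1) True]] e.hom_nat_pow[of x p] by simp
      next
        case False
        have "x [^]\<^bsub>L\<^esub> p \<in> carrier L" using x by simp
        then show ?thesis using False by (auto simp: L_iff L_one PiE_iff extensional_def)
      qed
    qed
    then show ?thesis using x cls.hom_nat_pow[of x p] by simp
  qed
  then show ?thesis using prime_p by unfold_locales
qed

lemma CD_invariant:
  assumes "A \<in> carrier C" "B \<in> carrier C" "E \<in> carrier C"
  shows "CD (A \<otimes>\<^bsub>C\<^esub> E) (B \<otimes>\<^bsub>C\<^esub> E) = CD A B"
proof -
  obtain x y z where xyz: "x \<in> carrier L" "y \<in> carrier L" "z \<in> carrier L" "A = cls x" "B = cls y" "E = cls z"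
    using assms by (meson C_cases)
  have "A \<otimes>\<^bsub>C\<^esub> E = cls (x \<otimes>\<^bsub>L\<^esub> z)" "B \<otimes>\<^bsub>C\<^esub> E = cls (y \<otimes>\<^bsub>L\<^esub> z)"
    using xyz by simp_all
  then show ?thesis using xyz(1-3) by (simp only: xyz(4,5) CD_cls pd_invariant L.m_closed)
qed

lemma CD_ultra:
  assumes "A \<in> carrier C" "B \<in> carrier C" "E \<in> carrier C"
  shows "CD A E \<le> max (CD A B) (CD B E)"
proof -
  obtain x y z where xyz: "x \<in> carrier L" "y \<in> carrier L" "z \<in> carrier L" "A = cls x" "B = cls y" "E = cls z"
    using assms by (meson C_cases)
  then show ?thesis using pd_ultra[of x y z] by (simp add: CD_cls)
qed

text \<open>Elements of the cone are represented by sequences growing linearly at all large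
  indices, whereas the constructions below only control almost all indices. Setting the sequence to
  the neutral element at the bad indices repairs this without changing its class.\<close>

lemma linear_seq_along_ultrafilter:
  assumes "\<forall>\<^sub>F n in \<omega>. f n \<in> carrier X \<and> d (f n) \<one> \<le> K * real n" "0 \<le> K"
  obtains x where "x \<in> carrier L" "\<forall>\<^sub>F n in \<omega>. x n = f n"
proof -
  define x where "x = (\<lambda>n\<in>{1..}. if f n \<in> carrier X \<and> d (f n) \<one> \<le> K * real n then f n else \<one>)"
  have "x \<in> carrier L"
    unfolding L_iff
  proof (intro conjI exI)
    show "\<forall>\<^sub>F n in sequentially. d (x n) \<one> \<le> K * real n"
      using eventually_ge_at_top[of 1] by eventually_elim (use assms(2) in \<open>auto simp: x_def d_refl\<close>)
  qed (auto simp: x_def)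
  moreover have "\<forall>\<^sub>F n in \<omega>. x n = f n"
    using assms(1) eventually_ge[of 1] by eventually_elim (auto simp: x_def)
  ultimately show thesis by (rule that)
qed

end

section \<open>Completeness and saturation of the cone\<close>

lemma hom_finprod:
  assumes "group_hom G H h" "comm_group G" "comm_group H" "finite F" "f \<in> F \<rightarrow> carrier G"
  shows "h (finprod G f F) = finprod H (\<lambda>i. h (f i)) F"
proof -
  interpret h: group_hom G H h by fact
  interpret G: comm_group G by fact
  interpret H: comm_group H by fact
  show ?thesis using assms(4,5)
  proof (induction F rule: finite_induct)
    case empty then show ?case by simp
  next
    case (insert i F)
    then have "f i \<in> carrier G" "f \<in> F \<rightarrow> carrier G" by auto
    moreover from this have "(\<lambda>i. h (f i)) \<in> F \<rightarrow> carrier H" by (simp add: Pi_iff)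
    ultimately show ?case using insert by simp
  qed
qed

context ultrametric_cone begin

lemma one_L_apply: "1 \<le> n \<Longrightarrow> \<one>\<^bsub>L\<^esub> n = \<one>"
  by (simp add: L_one)

lemma norm_lessD:
  assumes "x \<in> carrier L" "pd x \<one>\<^bsub>L\<^esub> < K"
  shows "\<forall>\<^sub>F n in \<omega>. d (x n) \<one> < K * real n"
  using pd_lessD[OF assms(1) L.one_closed assms(2)] eventually_ge[of 1]
  by eventually_elim (simp add: one_L_apply)

lemma norm_greaterD:
  assumes "x \<in> carrier L" "K < pd x \<one>\<^bsub>L\<^esub>"
  shows "\<forall>\<^sub>F n in \<omega>. K * real n < d (x n) \<one>"
  using pd_greaterD[OF assms(1) L.one_closed assms(2)] eventually_ge[of 1]
  by eventually_elim (simp add: one_L_apply)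

lemma norm_le:
  assumes "x \<in> carrier L" "\<forall>\<^sub>F n in \<omega>. d (x n) \<one> \<le> K * real n"
  shows "pd x \<one>\<^bsub>L\<^esub> \<le> K"
proof (rule pd_le[OF assms(1) L.one_closed])
  show "\<forall>\<^sub>F n in \<omega>. d (x n) (\<one>\<^bsub>L\<^esub> n) \<le> K * real n"
    using assms(2) eventually_ge[of 1] by eventually_elim (simp add: one_L_apply)
qed

lemma norm_ge:
  assumes "x \<in> carrier L" "\<forall>\<^sub>F n in \<omega>. K * real n \<le> d (x n) \<one>"
  shows "K \<le> pd x \<one>\<^bsub>L\<^esub>"
proof (rule pd_ge[OF assms(1) L.one_closed])
  show "\<forall>\<^sub>F n in \<omega>. K * real n \<le> d (x n) (\<one>\<^bsub>L\<^esub> n)"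
    using assms(2) eventually_ge[of 1] by eventually_elim (simp add: one_L_apply)
qed

lemma CD_one: "x \<in> carrier L \<Longrightarrow> CD (cls x) \<one>\<^bsub>C\<^esub> = pd x \<one>\<^bsub>L\<^esub>"
  using CD_cls[of x "\<one>\<^bsub>L\<^esub>"] by simp

text \<open>Given representatives \<open>x i\<close> of a Cauchy sequence, the limit is the diagonal sequence
  whose entry at \<open>n\<close> is that of \<open>x (m n)\<close>. Here \<open>m\<close> grows so slowly that at \<open>n\<close> the
  rescaled mutual distances of \<open>x 0, \<dots>, x (m n)\<close> are already close to their limits.\<close>

lemma complete_C: "C.mcomplete"
  unfolding C.mcomplete_def
proof (intro allI impI)
  fix \<sigma> assume \<sigma>: "C.MCauchy \<sigma>"
  have "\<forall>i. \<exists>x. x \<in> carrier L \<and> \<sigma> i = cls x"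
    using \<sigma> C_cases unfolding C.MCauchy_def by (metis rangeI subsetD)
  then obtain x where x: "\<And>i. x i \<in> carrier L" "\<And>i. \<sigma> i = cls (x i)" by metis
  have "C.mbounded (insert \<one>\<^bsub>C\<^esub> (range \<sigma>))"
    using C.MCauchy_imp_mbounded[OF \<sigma>] by (simp add: C.mbounded_insert)
  then obtain B where "\<forall>A\<in>range \<sigma>. CD A \<one>\<^bsub>C\<^esub> \<le> B" unfolding C.mbounded_alt by blast
  then have B: "pd (x i) \<one>\<^bsub>L\<^esub> \<le> B" for i using CD_one[OF x(1)[of i]] x(2)[of i] by (metis rangeI)
  have B0: "0 \<le> B" using B[of 0] pd_nonneg[OF x(1)[of 0] L.one_closed] by linarith
  define Q where "Q k n \<longleftrightarrow> 1 \<le> n \<and> (\<forall>i\<in>{..k}. d (x i n) \<one> \<le> (B + 1) * real n \<and>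
      (\<forall>j\<in>{..k}. d (x i n) (x j n) \<le> (pd (x i) (x j) + 1 / real (Suc k)) * real n))" for k n
  have "\<forall>\<^sub>F n in \<omega>. Q k n" for k
    unfolding Q_def
  proof (intro eventually_conj eventually_ball_finite ballI)
    show "\<forall>\<^sub>F n in \<omega>. d (x i n) \<one> \<le> (B + 1) * real n" for i
      using norm_lessD[OF x(1)[of i], of "B + 1"] B[of i] by (auto elim!: eventually_mono)
    show "\<forall>\<^sub>F n in \<omega>. d (x i n) (x j n) \<le> (pd (x i) (x j) + 1 / real (Suc k)) * real n" for i j
      using pd_lessD[OF x(1)[of i] x(1)[of j], of "pd (x i) (x j) + 1 / real (Suc k)"]
      by (auto elim!: eventually_mono)
  qed (auto intro: eventually_ge)
  then obtain m where m: "filterlim m sequentially \<omega>" "\<forall>\<^sub>F n in \<omega>. Q (m n) n"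
    using diagonal_choice[OF \<omega>_le] by blast
  have "\<forall>\<^sub>F n in \<omega>. x (m n) n \<in> carrier X \<and> d (x (m n) n) \<one> \<le> (B + 1) * real n"
    using m(2) by eventually_elim (auto simp: Q_def intro: L_closed[OF x(1)])
  then obtain y where y: "y \<in> carrier L" "\<forall>\<^sub>F n in \<omega>. y n = x (m n) n"
    by (rule linear_seq_along_ultrafilter) (use B0 in simp)
  have "limitin C.mtopology \<sigma> (cls y) sequentially"
    unfolding C.limit_metric_sequentially
  proof (intro conjI allI impI)
    show "cls y \<in> carrier C" using y(1) by simp
    fix e :: real assume e: "0 < e"
    then obtain M where M: "\<And>i j. M \<le> i \<Longrightarrow> M \<le> j \<Longrightarrow> CD (\<sigma> i) (\<sigma> j) < e / 3"
      using \<sigma> unfolding C.MCauchy_def by (meson divide_pos_pos zero_less_numeral)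
    obtain M' :: nat where M': "1 / real (Suc M') < e / 3"
      using e by (metis nat_approx_posE divide_pos_pos zero_less_numeral)
    have "CD (\<sigma> i) (cls y) < e" if i: "M \<le> i" for i
    proof -
      have "\<forall>\<^sub>F n in \<omega>. max i (max M M') \<le> m n"
        using m(1) unfolding filterlim_at_top by blast
      then have "\<forall>\<^sub>F n in \<omega>. d (x i n) (y n) \<le> (2 * e / 3) * real n"
        using m(2) y(2)
      proof eventually_elim
        fix n assume n: "max i (max M M') \<le> m n" "Q (m n) n" "y n = x (m n) n"
        have "d (x i n) (y n) \<le> (pd (x i) (x (m n)) + 1 / real (Suc (m n))) * real n"
          using n by (auto simp: Q_def)
        also have "\<dots> \<le> (2 * e / 3) * real n"
        proof (rule mult_right_mono)
          have "pd (x i) (x (m n)) < e / 3"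
            using M[OF i, of "m n"] n(1) x by (simp add: CD_cls)
          moreover have "1 / real (Suc (m n)) \<le> 1 / real (Suc M')"
            using n(1) by (simp add: frac_le)
          ultimately show "pd (x i) (x (m n)) + 1 / real (Suc (m n)) \<le> 2 * e / 3"
            using M' by linarith
        qed simp
        finally show "d (x i n) (y n) \<le> (2 * e / 3) * real n" .
      qed
      then have "pd (x i) y \<le> 2 * e / 3" by (rule pd_le[OF x(1) y(1)])
      then show ?thesis using e by (simp add: x(2) CD_cls[OF x(1) y(1)])
    qed
    moreover have "\<sigma> i \<in> carrier C" for i using x by simp
    ultimately show "\<exists>Na. \<forall>n\<ge>Na. \<sigma> n \<in> carrier C \<and> CD (\<sigma> n) (cls y) < e" by blast
  qed
  then show "\<exists>A. limitin C.mtopology \<sigma> A sequentially" by blast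
qed

lemma ultrametric_group_C: "ultrametric_group C p CD"
  by (intro ultrametric_group.intro ultrametric_group_axioms.intro elementary_C metric_C
      CD_invariant CD_ultra complete_C)

sublocale C: ultrametric_group C p CD by (rule ultrametric_group_C)

text \<open>A sequence in a countable set is encoded by its graph, a set of natural numbers.\<close>

lemma small_C: "carrier C \<lesssim> eps1"
proof -
  define g where "g x = (\<lambda>n. prod_encode (n, to_nat_on (carrier X) (x n))) ` {1..}" for x :: "nat \<Rightarrow> 'a"
  have "inj_on g (carrier L)"
  proof (rule inj_onI)
    fix x y assume x: "x \<in> carrier L" and y: "y \<in> carrier L" and eq: "g x = g y"
    show "x = y"
    proof
      fix n
      show "x n = y n"
      proof (cases "1 \<le> n")
        case True
        then have "prod_encode (n, to_nat_on (carrier X) (x n)) \<in> g y" using eq by (auto simp: g_def)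
        then have "to_nat_on (carrier X) (x n) = to_nat_on (carrier X) (y n)"
          by (auto simp: g_def prod_encode_eq)
        then show ?thesis
          using True x y L_closed inj_on_to_nat_on[OF countable_X] by (meson inj_onD)
      next
        case False
        then show ?thesis using x y by (auto simp: L_iff PiE_iff extensional_def)
      qed
    qed
  qed
  then have "carrier L \<lesssim> eps1" unfolding lepoll_def by blast
  moreover have "carrier C \<lesssim> carrier L" unfolding carrier_C by (rule image_lepoll)
  ultimately show ?thesis using lepoll_trans by blast
qed

lemma cls_lincomb:
  assumes "finite F" "\<And>i. i \<in> F \<Longrightarrow> y i \<in> carrier L"
  shows "cls (finprod L (\<lambda>i. y i [^]\<^bsub>L\<^esub> (c i :: int)) F) = finprod C (\<lambda>i. cls (y i) [^]\<^bsub>C\<^esub> c i) F"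
proof -
  have "cls (finprod L (\<lambda>i. y i [^]\<^bsub>L\<^esub> (c i :: int)) F) = finprod C (\<lambda>i. cls (y i [^]\<^bsub>L\<^esub> c i)) F"
    by (rule hom_finprod[OF cls_hom L.comm_group_axioms comm_group_C assms(1)]) (use assms in auto)
  also have "\<dots> = finprod C (\<lambda>i. cls (y i) [^]\<^bsub>C\<^esub> c i) F"
    by (rule C.finprod_cong) (use assms cls.hom_int_pow in \<open>auto simp: simp_implies_def\<close>)
  finally show ?thesis .
qed

lemma eval_lincomb:
  assumes "finite F" "\<And>i. i \<in> F \<Longrightarrow> y i \<in> carrier L" "1 \<le> n"
  shows "(finprod L (\<lambda>i. y i [^]\<^bsub>L\<^esub> (c i :: int)) F) n = (\<Otimes>i\<in>F. y i n [^] c i)"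
proof -
  interpret e: group_hom L X "\<lambda>x. x n" by (rule eval_hom[OF assms(3)])
  have "(finprod L (\<lambda>i. y i [^]\<^bsub>L\<^esub> (c i :: int)) F) n = (\<Otimes>i\<in>F. (y i [^]\<^bsub>L\<^esub> c i) n)"
    by (rule hom_finprod[OF eval_hom[OF assms(3)] L.comm_group_axioms comm_group_axioms assms(1)])
      (use assms in auto)
  also have "\<dots> = (\<Otimes>i\<in>F. y i n [^] c i)"
    by (rule finprod_cong) (use assms e.hom_int_pow L_closed in \<open>auto simp: simp_implies_def\<close>)
  finally show ?thesis .
qed

text \<open>Sets of natural numbers are the branches of a binary tree; finitely many branches are
  separated at some level.\<close>

lemma eventually_inj_on_truncation:
  assumes "finite \<F>"
  shows "\<forall>\<^sub>F k in sequentially. inj_on (\<lambda>S. set_encode (S \<inter> {..<k})) \<F>"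
proof -
  have "\<forall>\<^sub>F k in sequentially. \<forall>S\<in>\<F>. \<forall>T\<in>\<F>. S \<inter> {..<k} = T \<inter> {..<k} \<longrightarrow> S = T"
  proof (intro eventually_ball_finite ballI assms)
    fix S T :: "nat set"
    show "\<forall>\<^sub>F k in sequentially. S \<inter> {..<k} = T \<inter> {..<k} \<longrightarrow> S = T"
    proof (cases "S = T")
      case False
      then obtain e where e: "e \<in> S \<longleftrightarrow> e \<notin> T" by blast
      show ?thesis using eventually_gt_at_top[of e] by eventually_elim (use e in blast)
    qed simp
  qed
  then show ?thesis by eventually_elim (auto simp: inj_on_def set_encode_eq)
qed

text \<open>From countably many independent elements \<open>a i\<close> with representatives \<open>x i\<close> one obtains
  continuum many as follows. Identify indices with finite sets of natural numbers, by
  \<open>set_encode\<close>, and let \<open>m\<close> grow so slowly that at \<open>n\<close> all nontrivial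
  combinations of the \<open>x i\<close>, where \<open>i\<close> runs over the codes of sets of numbers below
  \<open>m n\<close>, already have rescaled length greater than \<open>s\<close>. For a set \<open>S\<close> let
  \<open>Y S\<close> be the sequence which at \<open>n\<close> takes the entry of \<open>x i\<close>, with
  \<open>i\<close> the code of the part of \<open>S\<close> below \<open>m n\<close>. Finitely many different sets
  have different codes at almost all \<open>n\<close>. There a nontrivial combination of the \<open>Y S\<close> is
  a nontrivial combination of the \<open>x i\<close>, and so its norm is at least \<open>s\<close>.\<close>

lemma saturated_C:
  assumes r: "0 < r" and s: "0 < s" and A: "infinite A" "A \<subseteq> C.V r" "C.indep (C.V s) (\<lambda>b. b) A"
  shows "\<exists>A'. A' \<subseteq> C.V (2 * r) \<and> C.indep (C.V (s / 2)) (\<lambda>b. b) A' \<and> eps1 \<lesssim> A'"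
proof -
  obtain a :: "nat \<Rightarrow> (nat \<Rightarrow> 'a) set" where a: "inj a" "range a \<subseteq> A"
    using infinite_countable_subset[OF A(1)] by blast
  have "C.indep (C.V s) (\<lambda>b. b) (range a)" by (rule C.indep_mono[OF A(3) order_refl a(2)])
  from C.indep_reindex[OF this a(1)] have ind: "C.indep (C.V s) a UNIV" by (simp add: o_def)
  have aV: "a i \<in> C.V r" for i using a(2) A(2) by blast
  have "a i \<in> cls ` carrier L" for i
    using aV[of i] C.V_subset[of r] unfolding carrier_C by (rule subsetD[rotated])
  then have "\<forall>i. \<exists>x. x \<in> carrier L \<and> a i = cls x" by blast
  then obtain x where x: "\<And>i. x i \<in> carrier L" "\<And>i. a i = cls (x i)" by metis
  define I where "I k = set_encode ` Pow {..<k}" for k :: nat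
  have finI: "finite (I k)" for k by (simp add: I_def)
  define Q where "Q k n \<longleftrightarrow> (\<forall>i\<in>I k. d (x i n) \<one> \<le> 2 * r * real n) \<and>
      (\<forall>c\<in>{c \<in> I k \<rightarrow>\<^sub>E {0..<int p}. \<exists>i\<in>I k. c i \<noteq> 0}. s * real n < d (\<Otimes>i\<in>I k. x i n [^] c i) \<one>)" for k n
  have "\<forall>\<^sub>F n in \<omega>. Q k n" for k
    unfolding Q_def
  proof (intro eventually_conj eventually_ball_finite ballI)
    show "\<forall>\<^sub>F n in \<omega>. d (x i n) \<one> \<le> 2 * r * real n" for i
    proof -
      have "pd (x i) \<one>\<^bsub>L\<^esub> < 2 * r" using aV[of i] r x by (simp add: C.V_def CD_one)
      from norm_lessD[OF x(1) this] show ?thesis by eventually_elim simp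
    qed
    show "finite (I k)" by (rule finI)
    have "finite (I k \<rightarrow>\<^sub>E {0..<int p})" by (rule finite_PiE) (simp_all add: finI)
    then show "finite {c \<in> I k \<rightarrow>\<^sub>E {0..<int p}. \<exists>i\<in>I k. c i \<noteq> 0}"
      by (rule rev_finite_subset) auto
    fix c assume "c \<in> {c \<in> I k \<rightarrow>\<^sub>E {0..<int p}. \<exists>i\<in>I k. c i \<noteq> 0}"
    then obtain i where c: "c \<in> I k \<rightarrow> {0..<int p}" "i \<in> I k" "c i \<noteq> 0" by auto
    define z where "z = finprod L (\<lambda>i. x i [^]\<^bsub>L\<^esub> c i) (I k)"
    have z: "z \<in> carrier L" unfolding z_def by (rule L.finprod_closed) (use x in auto)
    have "cls z = finprod C (\<lambda>i. a i [^]\<^bsub>C\<^esub> c i) (I k)"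
      unfolding z_def x(2) by (rule cls_lincomb[OF finI x(1)])
    then have "cls z \<notin> C.V s"
      using C.indepD[OF ind finI subset_UNIV c(1) _ c(2)] c(3) by auto
    then have "s < pd z \<one>\<^bsub>L\<^esub>" using z by (simp add: C.V_def CD_one)
    from norm_greaterD[OF z this] eventually_ge[of 1]
    show "\<forall>\<^sub>F n in \<omega>. s * real n < d (\<Otimes>i\<in>I k. x i n [^] c i) \<one>"
      by eventually_elim (simp add: z_def eval_lincomb[OF finI x(1)])
  qed
  then obtain m where m: "filterlim m sequentially \<omega>" "\<forall>\<^sub>F n in \<omega>. Q (m n) n"
    using diagonal_choice[OF \<omega>_le] by blast
  define code where "code k S = set_encode (S \<inter> {..<k})" for k and S :: "nat set"
  have codeI: "code k S \<in> I k" for k S by (auto simp: code_def I_def)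
  have bound: "\<forall>\<^sub>F n in \<omega>. x (code (m n) S) n \<in> carrier X \<and> d (x (code (m n) S) n) \<one> \<le> 2 * r * real n" for S
    using m(2) eventually_ge[of 1] by eventually_elim (use codeI L_closed[OF x(1)] in \<open>auto simp: Q_def\<close>)
  have "\<exists>y. y \<in> carrier L \<and> (\<forall>\<^sub>F n in \<omega>. y n = x (code (m n) S) n)" for S
    using linear_seq_along_ultrafilter[OF bound[of S]] r by (metis less_imp_le mult_nonneg_nonneg zero_le_numeral)
  then obtain Y where Y: "\<And>S. Y S \<in> carrier L" "\<And>S. \<forall>\<^sub>F n in \<omega>. Y S n = x (code (m n) S) n" by metis
  have YV: "cls (Y S) \<in> C.V (2 * r)" for S
  proof -
    have "\<forall>\<^sub>F n in \<omega>. d (Y S n) \<one> \<le> 2 * r * real n"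
      using bound[of S] Y(2)[of S] by eventually_elim simp
    then show ?thesis using norm_le[OF Y(1)] Y(1) by (simp add: C.V_def CD_one)
  qed
  have ind': "C.indep (C.V (s / 2)) (\<lambda>S. cls (Y S)) UNIV"
    unfolding C.indep_def
  proof (intro conjI allI impI)
    show "(\<lambda>S. cls (Y S)) \<in> UNIV \<rightarrow> carrier C" using Y(1) by auto
    fix F c assume H: "finite F \<and> F \<subseteq> UNIV \<and> c \<in> F \<rightarrow> {0..<int p} \<and>
        finprod C (\<lambda>S. cls (Y S) [^]\<^bsub>C\<^esub> c S) F \<in> C.V (s / 2)"
    then have F: "finite F" and c: "c \<in> F \<rightarrow> {0..<int p}" by auto
    define Z where "Z = finprod L (\<lambda>S. Y S [^]\<^bsub>L\<^esub> c S) F"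
    have Z: "Z \<in> carrier L" unfolding Z_def by (rule L.finprod_closed) (use Y(1) in auto)
    have "cls Z \<in> C.V (s / 2)" using H cls_lincomb[OF F Y(1)] by (simp add: Z_def)
    then have small: "pd Z \<one>\<^bsub>L\<^esub> \<le> s / 2" using Z by (simp add: C.V_def CD_one)
    show "\<forall>S\<in>F. c S = 0"
    proof (rule ccontr)
      assume "\<not> (\<forall>S\<in>F. c S = 0)"
      then obtain T where T: "T \<in> F" "c T \<noteq> 0" by blast
      have "\<forall>\<^sub>F n in \<omega>. inj_on (code (m n)) F"
        using filterlim_iff[THEN iffD1, OF m(1), rule_format, OF eventually_inj_on_truncation[OF F]]
        by (simp add: code_def[abs_def])
      moreover have "\<forall>\<^sub>F n in \<omega>. \<forall>S\<in>F. Y S n = x (code (m n) S) n"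
        by (rule eventually_ball_finite) (use F Y(2) in auto)
      ultimately have "\<forall>\<^sub>F n in \<omega>. s * real n \<le> d (Z n) \<one>"
        using m(2) eventually_ge[of 1]
      proof eventually_elim
        fix n
        assume inj: "inj_on (code (m n)) F" and Yx: "\<forall>S\<in>F. Y S n = x (code (m n) S) n"
          and Q: "Q (m n) n" and n: "1 \<le> n"
        let ?J = "code (m n) ` F"
        have J: "?J \<subseteq> I (m n)" using codeI by blast
        \<comment> \<open>The coefficients of the \<open>Y S\<close>, transported along the injective coding and extended by zero.\<close>
        define e where "e = (\<lambda>i\<in>I (m n). if i \<in> ?J then c (inv_into F (code (m n)) i) else 0)"
        have e_code: "e (code (m n) S) = c S" if "S \<in> F" for S
          using that codeI inj by (simp add: e_def)
        have xc: "x i n \<in> carrier X" for i using L_closed[OF x(1) n] .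
        have "Z n = (\<Otimes>S\<in>F. Y S n [^] c S)"
          unfolding Z_def by (rule eval_lincomb[OF F Y(1) n])
        also have "\<dots> = (\<Otimes>S\<in>F. x (code (m n) S) n [^] e (code (m n) S))"
          by (rule finprod_cong) (use Yx e_code xc in \<open>auto simp: simp_implies_def\<close>)
        also have "\<dots> = (\<Otimes>i\<in>?J. x i n [^] e i)"
          by (rule finprod_reindex[symmetric, OF _ inj]) (use xc in auto)
        also have "\<dots> = (\<Otimes>i\<in>I (m n). x i n [^] e i)"
          by (rule finprod_mono_neutral_cong_left[OF finI J]) (use xc in \<open>auto simp: e_def\<close>)
        finally have Zn: "Z n = (\<Otimes>i\<in>I (m n). x i n [^] e i)" .
        have "e \<in> I (m n) \<rightarrow>\<^sub>E {0..<int p}"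
        proof (rule PiE_I)
          fix i assume i: "i \<in> I (m n)"
          show "e i \<in> {0..<int p}"
          proof (cases "i \<in> ?J")
            case True
            then show ?thesis using e_code c by auto
          qed (use i p_pos in \<open>simp add: e_def\<close>)
        qed (simp add: e_def)
        moreover have "\<exists>i\<in>I (m n). e i \<noteq> 0" using e_code[OF T(1)] T(2) codeI by metis
        ultimately have "s * real n < d (Z n) \<one>" using Q unfolding Zn Q_def by blast
        then show "s * real n \<le> d (Z n) \<one>" by simp
      qed
      then have "s \<le> pd Z \<one>\<^bsub>L\<^esub>" by (rule norm_ge[OF Z])
      then show False using small s by simp
    qed
  qed
  have sub: "subgroup (C.V (s / 2)) C" by (rule C.subgroup_V) (use s in simp)
  have "C.indep (C.V (s / 2)) (\<lambda>b. b) (range (\<lambda>S. cls (Y S)))" by (rule C.indep_image[OF ind' sub])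
  moreover have "eps1 \<lesssim> range (\<lambda>S. cls (Y S))"
    using C.indep_imp_inj[OF ind' sub] by (simp add: inj_on_image_lepoll_2 lepoll_def) blast
  moreover have "range (\<lambda>S. cls (Y S)) \<subseteq> C.V (2 * r)" using YV by blast
  ultimately show ?thesis by blast
qed

theorem saturated_ultrametric_group_C: "saturated_ultrametric_group C p CD"
  by (intro saturated_ultrametric_group.intro saturated_ultrametric_group_axioms.intro
      ultrametric_group_C small_C saturated_C)

end

section \<open>Finitely supported functions with the length metric\<close>

context
  fixes p :: nat and J :: "nat set"
  assumes p: "Factorial_Ring.prime p"
begin

lemma p_gt_0: "0 < p"
  using p by (simp add: prime_gt_0_nat)

lemma Fsum_iff: "u \<in> carrier (Fsum p J) \<longleftrightarrow>
    u \<in> {1..} \<rightarrow>\<^sub>E {0..<int p} \<and> finite {n \<in> {1..}. u n \<noteq> 0} \<and> (\<forall>n\<in>{1..} - J. u n = 0)"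
  by (simp add: Fsum_def carrier_Fsum_iff[OF p_gt_0])

lemma subgroup_Fsum: "subgroup (carrier (Fsum p J)) (Fsum_pos p)"
proof (rule group.subgroupI)
  interpret P: group "Fsum_pos p" by simp
  show "group (Fsum_pos p)" by simp
  show sub: "carrier (Fsum p J) \<subseteq> carrier (Fsum_pos p)" by (auto simp: Fsum_def)
  have "\<one>\<^bsub>Fsum_pos p\<^esub> \<in> carrier (Fsum p J)"
    using P.one_closed by (simp add: Fsum_def)
  then show "carrier (Fsum p J) \<noteq> {}" by blast
  fix u assume u: "u \<in> carrier (Fsum p J)"
  then have uP: "u \<in> carrier (Fsum_pos p)" using sub by blast
  have "inv\<^bsub>Fsum_pos p\<^esub> u \<in> carrier (Fsum_pos p)" using uP by (rule P.inv_closed)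
  moreover have "inv\<^bsub>Fsum_pos p\<^esub> u = (\<lambda>n\<in>{1..}. inv\<^bsub>Fp p\<^esub> u n)" by (rule inv_sum_group[OF _ uP]) simp
  ultimately show "inv\<^bsub>Fsum_pos p\<^esub> u \<in> carrier (Fsum p J)"
    using u by (auto simp: Fsum_def)
  fix v assume v: "v \<in> carrier (Fsum p J)"
  then have "u \<otimes>\<^bsub>Fsum_pos p\<^esub> v \<in> carrier (Fsum_pos p)" using uP sub by (blast intro: P.m_closed)
  then show "u \<otimes>\<^bsub>Fsum_pos p\<^esub> v \<in> carrier (Fsum p J)"
    using u v by (auto simp: Fsum_def)
qed

lemma Fsum_mult: "u \<otimes>\<^bsub>Fsum p J\<^esub> v = (\<lambda>n\<in>{1..}. (u n + v n) mod int p)"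
  by (simp add: Fsum_def)

lemma Fsum_one: "\<one>\<^bsub>Fsum p J\<^esub> = (\<lambda>n\<in>{1..}. 0)"
  by (simp add: Fsum_def)

lemma elementary_Fsum: "elementary_group (Fsum p J) p"
proof -
  have "Fsum p J = (Fsum_pos p)\<lparr>carrier := carrier (Fsum p J)\<rparr>" by (simp add: Fsum_def)
  then have "group (Fsum p J)" using subgroup.subgroup_is_group[OF subgroup_Fsum] by simp
  then interpret comm_group "Fsum p J"
    by (rule group.group_comm_groupI) (simp add: Fsum_mult add.commute)
  have pow: "u [^]\<^bsub>Fsum p J\<^esub> k = (\<lambda>n\<in>{1..}. (int k * u n) mod int p)" if "u \<in> carrier (Fsum p J)" for u and k :: nat
  proof (induction k)
    case 0 then show ?case by (simp add: Fsum_one)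
  next
    case (Suc k)
    then show ?case by (auto simp: Fsum_mult fun_eq_iff mod_simps algebra_simps)
  qed
  show ?thesis
  proof
    show "Factorial_Ring.prime p" by (rule p)
    show "u [^]\<^bsub>Fsum p J\<^esub> p = \<one>\<^bsub>Fsum p J\<^esub>" if "u \<in> carrier (Fsum p J)" for u
      using pow[OF that, of p] by (simp add: Fsum_one)
  qed
qed

text \<open>The distance is the last place at which the two elements differ. In this form symmetry,
  invariance and the ultrametric inequality are evident.\<close>

lemma Fdist_eq:
  assumes u: "u \<in> carrier (Fsum p J)" and v: "v \<in> carrier (Fsum p J)"
  shows "Fdist p u v = real (Sup {n \<in> {1..}. u n \<noteq> v n})"
proof -
  have vP: "v \<in> carrier (Fsum_pos p)" using v by (simp add: Fsum_def)
  have "inv\<^bsub>Fsum_pos p\<^esub> v = (\<lambda>n\<in>{1..}. inv\<^bsub>Fp p\<^esub> v n)" by (rule inv_sum_group[OF _ vP]) simp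
  also have "\<dots> = (\<lambda>n\<in>{1..}. (- v n) mod int p)"
  proof (rule restrict_ext)
    fix n :: nat assume "n \<in> {1..}"
    then have "v n \<in> carrier (Fp p)" using v p_gt_0 by (auto simp: Fsum_iff carrier_integer_mod_group)
    then show "inv\<^bsub>Fp p\<^esub> v n = (- v n) mod int p" by (rule inv_integer_mod_group)
  qed
  finally have eq: "(u \<otimes>\<^bsub>Fsum_pos p\<^esub> inv\<^bsub>Fsum_pos p\<^esub> v) n = (u n - v n) mod int p" if "1 \<le> n" for n
    using that by (simp add: mod_simps)
  have "(u n - v n) mod int p = 0 \<longleftrightarrow> u n = v n" if "1 \<le> n" for n
  proof -
    have "u n \<in> {0..<int p}" "v n \<in> {0..<int p}" using u v that by (auto simp: Fsum_iff)
    then show ?thesis by (metis atLeastLessThan_iff mod_eq_dvd_iff mod_pos_pos_trivial dvd_eq_mod_eq_0)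
  qed
  then show ?thesis using eq unfolding Fdist_def supp_length_def
    by (metis (mono_tags, lifting) atLeast_iff)
qed

lemma finite_diff:
  assumes "u \<in> carrier (Fsum p J)" "v \<in> carrier (Fsum p J)"
  shows "finite {n \<in> {1..}. u n \<noteq> v n}"
  by (rule finite_subset[of _ "{n \<in> {1..}. u n \<noteq> 0} \<union> {n \<in> {1..}. v n \<noteq> 0}"])
    (use assms in \<open>auto simp: Fsum_iff\<close>)

lemma countable_Fsum: "countable (carrier (Fsum p J))"
proof -
  define g where "g u = {(n, u n) | n. n \<in> {1..} \<and> u n \<noteq> 0}" for u :: "nat \<Rightarrow> int"
  have "inj_on g (carrier (Fsum p J))"
  proof (rule inj_onI)
    fix u v assume u: "u \<in> carrier (Fsum p J)" and v: "v \<in> carrier (Fsum p J)" and eq: "g u = g v"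
    show "u = v"
    proof
      fix n
      show "u n = v n"
      proof (cases "1 \<le> n")
        case True
        have "(n, k) \<in> g u \<longleftrightarrow> (n, k) \<in> g v" for k using eq by simp
        then have "(k = u n \<and> u n \<noteq> 0) = (k = v n \<and> v n \<noteq> 0)" for k using True by (simp add: g_def)
        then show ?thesis by metis
      next
        case False
        then show ?thesis using u v by (auto simp: Fsum_iff PiE_iff extensional_def)
      qed
    qed
  qed
  moreover have "g ` carrier (Fsum p J) \<subseteq> Collect finite"
  proof
    fix A assume "A \<in> g ` carrier (Fsum p J)"
    then obtain u where u: "u \<in> carrier (Fsum p J)" "A = g u" by blast
    have "g u = (\<lambda>n. (n, u n)) ` {n \<in> {1..}. u n \<noteq> 0}" by (auto simp: g_def)
    then show "A \<in> Collect finite" using u by (simp add: Fsum_iff)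
  qed
  then have "countable (g ` carrier (Fsum p J))"
    using countable_Collect_finite countable_subset by blast
  ultimately show ?thesis by (rule countable_image_inj_on[rotated])
qed

lemma ultrametric_cone_Fsum:
  assumes "ultrafilter_on {1..} \<omega>" "nonprincipal \<omega>"
  shows "ultrametric_cone (Fsum p J) p (Fdist p) \<omega>"
proof -
  interpret elementary_group "Fsum p J" p by (rule elementary_Fsum)
  show ?thesis
  proof
    fix u v w assume u: "u \<in> carrier (Fsum p J)" and v: "v \<in> carrier (Fsum p J)"
    show "0 \<le> Fdist p u v" by (simp add: Fdist_def)
    show "Fdist p u v = Fdist p v u" using u v by (simp add: Fdist_eq eq_commute)
    assume w: "w \<in> carrier (Fsum p J)"
    have le: "n \<le> Sup S" if "finite S" "n \<in> S" for S and n :: nat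
      using that by (intro cSup_upper) auto
    have "Sup {n \<in> {1..}. u n \<noteq> w n} \<le> max (Sup {n \<in> {1..}. u n \<noteq> v n}) (Sup {n \<in> {1..}. v n \<noteq> w n})"
    proof (cases "{n \<in> {1..}. u n \<noteq> w n} = {}")
      case False
      then show ?thesis
      proof (rule cSup_least)
        fix n assume "n \<in> {n \<in> {1..}. u n \<noteq> w n}"
        then have "n \<in> {n \<in> {1..}. u n \<noteq> v n} \<or> n \<in> {n \<in> {1..}. v n \<noteq> w n}" by auto
        then show "n \<le> max (Sup {n \<in> {1..}. u n \<noteq> v n}) (Sup {n \<in> {1..}. v n \<noteq> w n})"
          using le[OF finite_diff[OF u v]] le[OF finite_diff[OF v w]] by (auto simp: le_max_iff_disj)
      qed
    qed (simp add: Sup_nat_def)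
    then show "Fdist p u w \<le> max (Fdist p u v) (Fdist p v w)"
      using u v w by (simp add: Fdist_eq)
    have "(u n + w n) mod int p = (v n + w n) mod int p \<longleftrightarrow> u n = v n" if "1 \<le> n" for n
    proof -
      have "u n \<in> {0..<int p}" "v n \<in> {0..<int p}" using u v that by (auto simp: Fsum_iff)
      then have "u n mod int p = u n" "v n mod int p = v n" by simp_all
      moreover have "(u n + w n) mod int p = (v n + w n) mod int p \<longleftrightarrow> u n mod int p = v n mod int p"
        by (simp add: mod_eq_dvd_iff)
      ultimately show ?thesis by simp
    qed
    then have "{n \<in> {1..}. (u \<otimes>\<^bsub>Fsum p J\<^esub> w) n \<noteq> (v \<otimes>\<^bsub>Fsum p J\<^esub> w) n} = {n \<in> {1..}. u n \<noteq> v n}"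
      by (auto simp: Fsum_mult)
    then show "Fdist p (u \<otimes>\<^bsub>Fsum p J\<^esub> w) (v \<otimes>\<^bsub>Fsum p J\<^esub> w) = Fdist p u v"
      using u v w by (simp add: Fdist_eq)
  next
    show "Fdist p u u = 0" if "u \<in> carrier (Fsum p J)" for u
      using that by (simp add: Fdist_eq Sup_nat_def)
  qed (use assms countable_Fsum in auto)
qed

end

theorem theorem6p21:
  fixes p :: nat and J :: "nat set" and \<omega> :: "nat filter"
  defines "C \<equiv> asymp_cone \<omega> (Fsum p J) (Fdist p)"
    and "D \<equiv> cone_dist \<omega> (Fsum p J) (Fdist p)"
  defines "T \<equiv> Metric_space.mtopology (carrier C) D"
    and "bounded_G \<equiv> Metric_space.mbounded (carrier C) D (carrier C)"
    and "proper_G \<equiv> proper_space (carrier C) D"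
  defines "G \<equiv> (C, T)"
    and "discrete_G \<equiv> T = discrete_topology (carrier C)"
  assumes "Factorial_Ring.prime p"
    and "J \<subseteq> {1..}"
    and "ultrafilter_on {1..} \<omega>"
    and "nonprincipal \<omega>"
  shows "(discrete_G \<longrightarrow>
            (bounded_G \<and> proper_G \<longrightarrow> (\<exists>n::nat. G \<simeq>\<^sub>t Fprod p {..<n})) \<and>
            (\<not> bounded_G \<and> proper_G \<longrightarrow> G \<simeq>\<^sub>t Fdsum p eps0) \<and>
            (\<not> proper_G \<longrightarrow> G \<simeq>\<^sub>t Fdsum p eps1)) \<and>
         (locally_compact_space T \<and> \<not> discrete_G \<longrightarrow>
            (compact_space T \<longleftrightarrow> bounded_G \<and> proper_G) \<and>
            (compact_space T \<longrightarrow> G \<simeq>\<^sub>t Fprod p eps0) \<and>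
            (\<not> bounded_G \<and> proper_G \<longrightarrow> G \<simeq>\<^sub>t Fprod p eps0 \<times>\<^sub>t Fdsum p eps0) \<and>
            (\<not> proper_G \<longrightarrow> G \<simeq>\<^sub>t Fprod p eps0 \<times>\<^sub>t Fdsum p eps1)) \<and>
         (\<not> locally_compact_space T \<longrightarrow> G \<simeq>\<^sub>t power_group (Fdsum p eps1) eps0)"
proof -
  interpret cone: ultrametric_cone "Fsum p J" p "Fdist p" \<omega>
    using assms(8,10,11) by (rule ultrametric_cone_Fsum)
  interpret saturated_ultrametric_group C p D
    unfolding C_def D_def by (rule cone.saturated_ultrametric_group_C)
  show ?thesis
    unfolding G_def discrete_G_def proper_G_def bounded_G_def T_def
    using classification compact_iff non_locally_compact_structure by blast
qed

end
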